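(* Let $a,b,F,\dot I_0,\dot d_0,\dot z_1,\dot z_2,\dot z_3\in\mathbb C$. (1) If $F\ne0$, then $V(0,\dot d_0,\dot z_1,0,0)\otimes A'(a,b;F)$ is a simple $\mathcal L$-module. (2) $V(0,\dot d_0,\dot z_1,0,0)\otimes A'(a,b;0)$ is a simple $\mathcal L$-module if and only if $V(\dot d_0,\dot z_1)\otimes A'(a,b)$ is a simple $\mathrm{Vir}$-module. (3) Suppose $(\dot I_0,\dot z_2,\dot z_3)\ne(0,0,0)$ and $A(a,b;F)$ is simple. Then $V(\dot I_0,\dot d_0,\dot z_1,\dot z_2,\dot z_3)\otimes A(a,b;F)$ is simple if and only if $(\rho_n(\widetilde Q_1),\rho_n(\widetilde Q_2))\ne(0,0)$ for all $n\in\mathbb Z$. (4) Suppose $(\dot I_0,\dot z_2,\dot z_3)\ne(0,0,0)$ and $(a,b,F)=(0,0,0)$. Then $V(\dot I_0,\dot d_0,\dot z_1,\dot z_2,\dot z_3)\otimes A'(0,0;0)$ is simple if and only if $(\rho_n(\widetilde Q_1),\rho_n(\widetilde Q_2))\ne(0,0)$ for all $n\in\mathbb Z\setminus\{0\}$.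
   Context: $\mathcal{L}$ has basis $\{d_n,I_n,z_1,z_2,z_3\mid n\in\mathbb{Z}\}$ with brackets $[d_n,d_m]=(m-n)d_{m+n}+\delta_{n,-m}\frac{n^3-n}{12}z_1$, $[d_n,I_m]=mI_{m+n}+\delta_{n,-m}(n^2+n)z_2$, $[I_n,I_m]=n\delta_{n,-m}z_3$, $z_i$ central; $\mathrm{Vir}=\mathrm{span}\{d_i,z_1\}$. $\mathcal L^-=\mathrm{span}\{d_{-n},I_{-n}\mid n\in\mathbb N\}$, and $U(\mathcal L^-)_{-k}$ is the subspace of $U(\mathcal L^-)$ of degree $-k$ (degree of $d_i,I_i$ is $i$). The Verma module $M(\dot I_0,\dot d_0,\dot z_1,\dot z_2,\dot z_3)=U(\mathcal L)/\mathcal I$, with $\mathcal I$ the left ideal generated by $d_n,I_n$ ($n\in\mathbb N$), $d_0-\dot d_0$, $I_0-\dot I_0$, $z_i-\dot z_i$; $w=1+\mathcal I$; $V(\dot I_0,\dot d_0,\dot z_1,\dot z_2,\dot z_3)$ is its simple quotient. When $(\dot I_0,\dot z_2,\dot z_3)\ne(0,0,0)$, there are weight vectors (possibly zero) $\widetilde Q_1,\widetilde Q_2\in U(\mathcal L^-)$ such that the maximal proper submodule of $M(\dot I_0,\dot d_0,\dot z_1,\dot z_2,\dot z_3)$ equals $U(\mathcal L^-)\widetilde Q_1w+U(\mathcal L^-)\widetilde Q_2w$; these are fixed. For $n\in\mathbb Z$, $\rho_n:U(\mathcal L^-)\to\mathbb C$ is the linear map defined inductively by $\rho_n(1)=1$,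 $\rho_n(I_{-i}u)=-F\rho_n(u)$, $\rho_n(d_{-i}u)=-(a+k+i+n-ib)\rho_n(u)$ for $i\in\mathbb N$, $u\in U(\mathcal L^-)_{-k}$. $V(h,c)$ is the simple highest weight $\mathrm{Vir}$-module with highest weight $d_0=h$, $z_1=c$. $A(a,b;F)=\mathbb{C}[x,x^{-1}]$ with $z_1=z_2=z_3=0$, $d_nx^m=(a+m+nb)x^{m+n}$, $I_nx^m=Fx^{m+n}$; it is simple unless $a\in\mathbb Z$, $b\in\{0,1\}$, $F=0$, and $A'(a,b;F)$ is its unique nontrivial simple subquotient; $A'(a,b)$ is $A'(a,b;0)$ regarded as a $\mathrm{Vir}$-module. *)

theory Defs
  imports Complex_Main "HOL-Library.Function_Algebras"
begin

text \<open>Basis of L: d_n = D n, I_n = J n, and the central elements z_1, z_2, z_3.\<close>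
datatype gen = D int | J int | Z1 | Z2 | Z3

text \<open>Bracket of two basis elements, as a finite linear combination of basis elements.\<close>
fun br :: "gen \<Rightarrow> gen \<Rightarrow> (complex \<times> gen) list" where
  "br (D n) (D m) = [(of_int (m - n), D (m + n))]
      @ (if n = - m then [(of_int (n^3 - n) / 12, Z1)] else [])"
| "br (D n) (J m) = [(of_int m, J (m + n))]
      @ (if n = - m then [(of_int (n^2 + n), Z2)] else [])"
| "br (J n) (D m) = [(- of_int n, J (n + m))]
      @ (if m = - n then [(- of_int (m^2 + m), Z2)] else [])"
| "br (J n) (J m) = (if n = - m then [(of_int n, Z3)] else [])"
| "br _ _ = []"

definition Vir_gens :: "gen set" where
  "Vir_gens = range D \<union> {Z1}"

text \<open>A representation of the span of the basis elements in G (G = UNIV for L, G = Vir_gens for Vir)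
  on the subspace C of the complex vector space (scalar multiplication sc); act g is the action of
  basis element g.\<close>
definition is_rep :: "gen set \<Rightarrow> (complex \<Rightarrow> 'v::ab_group_add \<Rightarrow> 'v) \<Rightarrow> 'v set
    \<Rightarrow> (gen \<Rightarrow> 'v \<Rightarrow> 'v) \<Rightarrow> bool" where
  "is_rep G sc C act \<longleftrightarrow> vector_space sc \<and> module.subspace sc C
    \<and> (\<forall>g\<in>G. \<forall>x\<in>C. act g x \<in> C)
    \<and> (\<forall>g\<in>G. \<forall>x\<in>C. \<forall>y\<in>C. act g (x + y) = act g x + act g y)
    \<and> (\<forall>g\<in>G. \<forall>c. \<forall>x\<in>C. act g (sc c x) = sc c (act g x))
    \<and> (\<forall>g\<in>G. \<forall>h\<in>G. \<forall>x\<in>C. act g (act h x) - act h (act g x)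
          = sum_list (map (\<lambda>(c, k). sc c (act k x)) (br g h)))"

definition submodule :: "gen set \<Rightarrow> (complex \<Rightarrow> 'v::ab_group_add \<Rightarrow> 'v) \<Rightarrow> 'v set
    \<Rightarrow> (gen \<Rightarrow> 'v \<Rightarrow> 'v) \<Rightarrow> 'v set \<Rightarrow> bool" where
  "submodule G sc C act S \<longleftrightarrow> S \<subseteq> C \<and> module.subspace sc S \<and> (\<forall>g\<in>G. \<forall>x\<in>S. act g x \<in> S)"

definition simple_rep :: "gen set \<Rightarrow> (complex \<Rightarrow> 'v::ab_group_add \<Rightarrow> 'v) \<Rightarrow> 'v set
    \<Rightarrow> (gen \<Rightarrow> 'v \<Rightarrow> 'v) \<Rightarrow> bool" where
  "simple_rep G sc C act \<longleftrightarrow> C \<noteq> {0} \<and> (\<forall>S. submodule G sc C act S \<longrightarrow> S = {0} \<or> S = C)"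

definition is_hw_L :: "(complex \<Rightarrow> 'v::ab_group_add \<Rightarrow> 'v) \<Rightarrow> 'v set \<Rightarrow> (gen \<Rightarrow> 'v \<Rightarrow> 'v)
    \<Rightarrow> complex \<Rightarrow> complex \<Rightarrow> complex \<Rightarrow> complex \<Rightarrow> complex \<Rightarrow> 'v \<Rightarrow> bool" where
  "is_hw_L sc C act I0 d0 z1 z2 z3 w \<longleftrightarrow> w \<in> C \<and> w \<noteq> 0
     \<and> (\<forall>n>0. act (D n) w = 0 \<and> act (J n) w = 0)
     \<and> act (D 0) w = sc d0 w \<and> act (J 0) w = sc I0 w
     \<and> act Z1 w = sc z1 w \<and> act Z2 w = sc z2 w \<and> act Z3 w = sc z3 w"

definition is_hw_Vir :: "(complex \<Rightarrow> 'v::ab_group_add \<Rightarrow> 'v) \<Rightarrow> 'v set \<Rightarrow> (gen \<Rightarrow> 'v \<Rightarrow> 'v)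
    \<Rightarrow> complex \<Rightarrow> complex \<Rightarrow> 'v \<Rightarrow> bool" where
  "is_hw_Vir sc C act h c w \<longleftrightarrow> w \<in> C \<and> w \<noteq> 0
     \<and> (\<forall>n>0. act (D n) w = 0) \<and> act (D 0) w = sc h w \<and> act Z1 w = sc c w"

text \<open>(C, act) is (isomorphic to) V(I0,d0,z1,z2,z3): a simple L-module with a highest weight vector
  of that highest weight.\<close>
definition is_V_L :: "(complex \<Rightarrow> 'v::ab_group_add \<Rightarrow> 'v) \<Rightarrow> 'v set \<Rightarrow> (gen \<Rightarrow> 'v \<Rightarrow> 'v)
    \<Rightarrow> complex \<Rightarrow> complex \<Rightarrow> complex \<Rightarrow> complex \<Rightarrow> complex \<Rightarrow> bool" where
  "is_V_L sc C act I0 d0 z1 z2 z3 \<longleftrightarrow> is_rep UNIV sc C act \<and> simple_rep UNIV sc C act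
     \<and> (\<exists>w. is_hw_L sc C act I0 d0 z1 z2 z3 w)"

definition is_V_Vir :: "(complex \<Rightarrow> 'v::ab_group_add \<Rightarrow> 'v) \<Rightarrow> 'v set \<Rightarrow> (gen \<Rightarrow> 'v \<Rightarrow> 'v)
    \<Rightarrow> complex \<Rightarrow> complex \<Rightarrow> bool" where
  "is_V_Vir sc C act h c \<longleftrightarrow> is_rep Vir_gens sc C act \<and> simple_rep Vir_gens sc C act
     \<and> (\<exists>w. is_hw_Vir sc C act h c w)"

definition neg_gen :: "gen \<Rightarrow> bool" where
  "neg_gen g \<longleftrightarrow> (\<exists>n<0. g = D n \<or> g = J n)"

fun wact :: "(gen \<Rightarrow> 'v \<Rightarrow> 'v) \<Rightarrow> gen list \<Rightarrow> 'v \<Rightarrow> 'v" where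
  "wact act [] v = v"
| "wact act (g # u) v = act g (wact act u v)"

fun deg :: "gen list \<Rightarrow> int" where
  "deg [] = 0"
| "deg (D m # u) = m + deg u"
| "deg (J m # u) = m + deg u"
| "deg (_ # u) = deg u"

fun pbw_key :: "gen \<Rightarrow> nat" where
  "pbw_key (D n) = 2 * nat (- n)"
| "pbw_key (J n) = 2 * nat (- n) + 1"
| "pbw_key _ = 0"

definition pbw :: "gen list \<Rightarrow> bool" where
  "pbw u \<longleftrightarrow> (\<forall>g\<in>set u. neg_gen g) \<and> sorted (map pbw_key u)"

text \<open>Elements of U(L^-) represented by elements of the free associative algebra on the basis
  of L^-: finite lists of (coefficient, word).\<close>
type_synonym uelt = "(complex \<times> gen list) list"

definition fa_act :: "(complex \<Rightarrow> 'v::ab_group_add \<Rightarrow> 'v) \<Rightarrow> (gen \<Rightarrow> 'v \<Rightarrow> 'v) \<Rightarrow> uelt \<Rightarrow> 'v \<Rightarrow> 'v" where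
  "fa_act sc act Q v = sum_list (map (\<lambda>(c, u). sc c (wact act u v)) Q)"

definition homog :: "uelt \<Rightarrow> bool" where
  "homog Q \<longleftrightarrow> (\<forall>(c, u)\<in>set Q. \<forall>g\<in>set u. neg_gen g)
     \<and> (\<exists>k. \<forall>(c, u)\<in>set Q. deg u = k)"

text \<open>(C, act, w) is the Verma module M(I0,d0,z1,z2,z3) with generator w: w is a highest weight vector
  and the PBW monomials of U(L^-) applied to w form a basis of C (i.e. u \<mapsto> u w is a linear
  isomorphism U(L^-) \<rightarrow> C).\<close>
definition is_Verma :: "(complex \<Rightarrow> 'v::ab_group_add \<Rightarrow> 'v) \<Rightarrow> 'v set \<Rightarrow> (gen \<Rightarrow> 'v \<Rightarrow> 'v)
    \<Rightarrow> complex \<Rightarrow> complex \<Rightarrow> complex \<Rightarrow> complex \<Rightarrow> complex \<Rightarrow> 'v \<Rightarrow> bool" where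
  "is_Verma sc C act I0 d0 z1 z2 z3 w \<longleftrightarrow> is_rep UNIV sc C act
     \<and> is_hw_L sc C act I0 d0 z1 z2 z3 w
     \<and> C = module.span sc {wact act u w | u. pbw u}
     \<and> (\<forall>W c. finite W \<longrightarrow> W \<subseteq> {u. pbw u}
          \<longrightarrow> (\<Sum>u\<in>W. sc (c u) (wact act u w)) = 0 \<longrightarrow> (\<forall>u\<in>W. c u = 0))"

definition max_sub_gen :: "(complex \<Rightarrow> 'v::ab_group_add \<Rightarrow> 'v) \<Rightarrow> 'v set \<Rightarrow> (gen \<Rightarrow> 'v \<Rightarrow> 'v)
    \<Rightarrow> 'v \<Rightarrow> uelt \<Rightarrow> uelt \<Rightarrow> bool" where
  "max_sub_gen sc C act w Q1 Q2 \<longleftrightarrow>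
    (let N = module.span sc ({wact act u (fa_act sc act Q1 w) | u. \<forall>g\<in>set u. neg_gen g}
                           \<union> {wact act u (fa_act sc act Q2 w) | u. \<forall>g\<in>set u. neg_gen g})
     in submodule UNIV sc C act N \<and> N \<noteq> C
        \<and> (\<forall>S. submodule UNIV sc C act S \<and> S \<noteq> C \<longrightarrow> S \<subseteq> N))"

fun rho :: "complex \<Rightarrow> complex \<Rightarrow> complex \<Rightarrow> int \<Rightarrow> gen list \<Rightarrow> complex" where
  "rho a b F n [] = 1"
| "rho a b F n (D m # u) =
     - (a + of_int (- deg u) + of_int (- m) + of_int n - of_int (- m) * b) * rho a b F n u"
| "rho a b F n (J m # u) = - F * rho a b F n u"
| "rho a b F n (_ # u) = 0"

definition rhoQ :: "complex \<Rightarrow> complex \<Rightarrow> complex \<Rightarrow> int \<Rightarrow> uelt \<Rightarrow> complex" where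
  "rhoQ a b F n Q = (\<Sum>(c, u)\<leftarrow>Q. c * rho a b F n u)"

text \<open>A(a,b;F) = C[x,x^{-1}], an element given by its finitely supported coefficient function.\<close>
definition A_carrier :: "(int \<Rightarrow> complex) set" where
  "A_carrier = {f. finite {m. f m \<noteq> 0}}"

definition A_act :: "complex \<Rightarrow> complex \<Rightarrow> complex \<Rightarrow> gen \<Rightarrow> (int \<Rightarrow> complex) \<Rightarrow> int \<Rightarrow> complex" where
  "A_act a b F g f = (\<lambda>m. case g of
      D n \<Rightarrow> (a + of_int (m - n) + of_int n * b) * f (m - n)
    | J n \<Rightarrow> F * f (m - n)
    | _ \<Rightarrow> 0)"

definition tsc :: "(complex \<Rightarrow> 'v \<Rightarrow> 'v) \<Rightarrow> complex \<Rightarrow> (int \<Rightarrow> 'v) \<Rightarrow> int \<Rightarrow> 'v" where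
  "tsc sc c f = (\<lambda>m. sc c (f m))"

text \<open>Index set of the basis x^m of A'(a,b;F): all m, except m = -a in the non-simple case
  (a integer, b in {0,1}, F = 0), where A' = A / C x^{-a} (b = 0) resp.
  A' = span{x^m | m \<noteq> -a} (b = 1).\<close>
definition Aprime_set :: "complex \<Rightarrow> complex \<Rightarrow> complex \<Rightarrow> int set" where
  "Aprime_set a b F = (if a \<in> \<int> \<and> (b = 0 \<or> b = 1) \<and> F = 0 then {m. of_int m \<noteq> - a} else UNIV)"

text \<open>The tensor product V \<otimes> A_M, where A_M has basis x^m (m in M) and the A(a,b;F)-action
  (truncated to M): an element is the finitely supported family (v_m) representing \<Sum> v_m \<otimes> x^m.\<close>
definition tens_carrier :: "'v::zero set \<Rightarrow> int set \<Rightarrow> (int \<Rightarrow> 'v) set" where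
  "tens_carrier C M = {f. finite {m. f m \<noteq> 0} \<and> (\<forall>m. f m \<in> C) \<and> (\<forall>m. m \<notin> M \<longrightarrow> f m = 0)}"

definition tens_act :: "(complex \<Rightarrow> 'v::ab_group_add \<Rightarrow> 'v) \<Rightarrow> (gen \<Rightarrow> 'v \<Rightarrow> 'v)
    \<Rightarrow> complex \<Rightarrow> complex \<Rightarrow> complex \<Rightarrow> int set \<Rightarrow> gen \<Rightarrow> (int \<Rightarrow> 'v) \<Rightarrow> int \<Rightarrow> 'v" where
  "tens_act sc act a b F M g f = (\<lambda>m. if m \<in> M then act g (f m) +
     (case g of
        D n \<Rightarrow> sc (a + of_int (m - n) + of_int n * b) (f (m - n))
      | J n \<Rightarrow> sc F (f (m - n))
      | _ \<Rightarrow> 0) else 0)"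

end

theory Submission
  imports Defs "HOL-Computational_Algebra.Polynomial" "HOL-Library.Product_Plus"
begin

text \<open>Let w be the highest weight vector of V. On a fixed element of the tensor product, d_c and I_c with c
  large act through the second factor only, by coefficients that are affine in the index; taking
  combinations, every nonzero submodule S contains w (x) x^m for all large m. For a word u in
  negative generators, u w (x) x^m is congruent to rho_n(u) w (x) x^n modulo S, provided S contains
  w (x) x^k for all k > n and the two vectors have equal weight. So a relation Q w = 0 in V with
  rho_n(Q) nonzero forces w (x) x^n into S, and S is everything if this works for every n. If rho_n
  kills both generators of the relations of V, it descends to V and yields a functional showing that
  w (x) x^n is not in the submodule generated by the w (x) x^m with m > n. When I_0, z_2, z_3 act
  by 0 on w, all I_n act by 0 on V: for nonzero F the relation I_{-1} w = 0 serves as Q, and for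
  F = 0 only Vir acts nontrivially.\<close>

section \<open>Highest weight modules\<close>

text \<open>The enveloping algebra is never formed: its elements are lists of weighted words, and
  equality of two of them is visible only through their action on the Verma vector. As
  \<open>rho\<close> is defined on words, it must be shown to respect brackets and then be carried
  over by linear independence of the PBW monomials. V is given only as some simple highest weight
  module, so the surjection from the Verma module onto V has to be constructed too; its kernel is
  the maximal submodule.

  The recursion of \<open>rho\<close> is the Leibniz rule read backwards: (g v) (x) x^m is g (v (x)
  x^m) minus a multiple of v (x) x^(m + deg g), and the first term lies in S as soon as v (x) x^m
  does.

  To isolate a summand, coefficients independent of the index are wanted. I_c yields them with
  factor F, second differences of d_(c-s) d_s with factor 2b(1-b). Both factors vanish exactly if F
  = 0 and b is 0 or 1; then the coefficients a + m + cb are carried along, since a product of two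
  successive ones is again such a coefficient times an affine function.\<close>

locale rep_space =
  fixes G :: "gen set" and sc :: "complex \<Rightarrow> 'v::ab_group_add \<Rightarrow> 'v"
    and C :: "'v set" and act :: "gen \<Rightarrow> 'v \<Rightarrow> 'v"
  assumes rep: "is_rep G sc C act"
begin

sublocale vector_space sc
  using rep unfolding is_rep_def by blast

lemma subspace_C: "subspace C"
  using rep unfolding is_rep_def by blast

lemma act_in: "g \<in> G \<Longrightarrow> x \<in> C \<Longrightarrow> act g x \<in> C"
  using rep unfolding is_rep_def by blast

lemma act_add: "g \<in> G \<Longrightarrow> x \<in> C \<Longrightarrow> y \<in> C \<Longrightarrow> act g (x + y) = act g x + act g y"
  using rep unfolding is_rep_def by blast

lemma act_scale: "g \<in> G \<Longrightarrow> x \<in> C \<Longrightarrow> act g (sc c x) = sc c (act g x)"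
  using rep unfolding is_rep_def by blast

lemma act_comm: "g \<in> G \<Longrightarrow> h \<in> G \<Longrightarrow> x \<in> C \<Longrightarrow>
    act g (act h x) = act h (act g x) + (\<Sum>(c, k)\<leftarrow>br g h. sc c (act k x))"
  using rep unfolding is_rep_def by (metis add.commute diff_add_cancel)

lemma zero_in: "0 \<in> C" and add_in: "x \<in> C \<Longrightarrow> y \<in> C \<Longrightarrow> x + y \<in> C"
  and scale_in: "x \<in> C \<Longrightarrow> sc c x \<in> C"
  using subspace_C by (simp_all add: subspace_0 subspace_add subspace_scale)

lemma act_zero: "g \<in> G \<Longrightarrow> act g 0 = 0"
  using act_scale[of g 0 0] zero_in by simp

lemma act_diff: "g \<in> G \<Longrightarrow> x \<in> C \<Longrightarrow> y \<in> C \<Longrightarrow> act g (x - y) = act g x - act g y"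
  using act_add[of g x "sc (- 1) y"] act_scale[of g y "- 1"] scale_in[of y "- 1"] by simp

lemma act_sum: "g \<in> G \<Longrightarrow> (\<And>i. i \<in> I \<Longrightarrow> x i \<in> C) \<Longrightarrow> act g (sum x I) = (\<Sum>i\<in>I. act g (x i))"
proof (induction I rule: infinite_finite_induct)
  case (insert i I)
  then show ?case using subspace_sum[OF subspace_C, of I x] by (simp add: act_add)
qed (auto simp: act_zero)

lemma wact_in: "set u \<subseteq> G \<Longrightarrow> x \<in> C \<Longrightarrow> wact act u x \<in> C"
  by (induction u) (auto simp: act_in)

lemma submoduleI:
  assumes "S \<subseteq> C" "0 \<in> S" "\<And>x y. x \<in> S \<Longrightarrow> y \<in> S \<Longrightarrow> x + y \<in> S"
    "\<And>c x. x \<in> S \<Longrightarrow> sc c x \<in> S" "\<And>g x. g \<in> G \<Longrightarrow> x \<in> S \<Longrightarrow> act g x \<in> S"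
  shows "submodule G sc C act S"
  using assms by (simp add: submodule_def subspace_def)

lemma sum_list_in_subspace:
  assumes "subspace S" "\<And>c k. (c, k) \<in> set l \<Longrightarrow> f k \<in> S"
  shows "(\<Sum>(c, k)\<leftarrow>l. sc c (f k)) \<in> S"
  using assms(2)
proof (induction l)
  case Nil
  show ?case using assms(1) by (simp add: subspace_0)
next
  case (Cons p l)
  obtain c k where p: "p = (c, k)" by force
  show ?case using Cons assms(1) unfolding p by (auto intro!: subspace_add subspace_scale)
qed

lemma act_span:
  assumes "g \<in> G" "E \<subseteq> C" "subspace S" "\<And>e. e \<in> E \<Longrightarrow> act g e \<in> S" "x \<in> span E"
  shows "act g x \<in> S"
proof -
  have "x \<in> C \<and> act g x \<in> S"
    using assms(5)
  proof (induction rule: span_induct_alt)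
    case base
    show ?case using assms zero_in by (simp add: act_zero subspace_0)
  next
    case (step c e y)
    then show ?case using assms
      by (auto simp: act_add act_scale scale_in add_in subspace_add subspace_scale)
  qed
  then show ?thesis by blast
qed

text \<open>With p a polynomial vanishing at all the eigenvalues of the given eigenvectors, p(act g)
  annihilates x and multiplies it by p(mu).\<close>
lemma eigenvector_in_span_zero:
  assumes g: "g \<in> G" and E: "E \<subseteq> C"
    and eig: "\<And>e. e \<in> E \<Longrightarrow> \<exists>l. l \<noteq> \<mu> \<and> act g e = sc l e"
    and x: "x \<in> span E" "act g x = sc \<mu> x"
  shows "x = 0"
proof -
  obtain t r where t: "finite t" "t \<subseteq> E" "x = (\<Sum>e\<in>t. sc (r e) e)"
    using x(1) unfolding span_explicit by blast
  obtain l where l: "\<And>e. e \<in> E \<Longrightarrow> l e \<noteq> \<mu> \<and> act g e = sc (l e) e"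
    using eig by metis
  have xC: "x \<in> C" using x(1) E subspace_C span_minimal by blast
  have pow: "sc (\<mu> ^ j) x = (\<Sum>e\<in>t. sc (l e ^ j) (sc (r e) e))" for j
  proof (induction j)
    case 0
    show ?case using t by simp
  next
    case (Suc j)
    have "sc (\<mu> ^ Suc j) x = act g (sc (\<mu> ^ j) x)"
      using g xC x(2) by (simp add: act_scale mult.commute)
    also have "\<dots> = (\<Sum>e\<in>t. act g (sc (l e ^ j) (sc (r e) e)))"
      unfolding Suc using g t E by (intro act_sum) (auto simp: scale_in)
    also have "\<dots> = (\<Sum>e\<in>t. sc (l e ^ Suc j) (sc (r e) e))"
    proof (rule sum.cong[OF refl])
      fix e assume "e \<in> t"
      then have "e \<in> E" "e \<in> C" using t E by auto
      then show "act g (sc (l e ^ j) (sc (r e) e)) = sc (l e ^ Suc j) (sc (r e) e)"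
        using g l[of e] by (simp add: act_scale scale_in ac_simps)
    qed
    finally show ?case .
  qed
  define p where "p = (\<Prod>e\<in>t. [:- l e, 1:])"
  have "sc (poly p \<mu>) x = (\<Sum>j\<le>degree p. sc (coeff p j) (sc (\<mu> ^ j) x))"
    by (simp add: poly_altdef scale_sum_left)
  also have "\<dots> = (\<Sum>j\<le>degree p. \<Sum>e\<in>t. sc (coeff p j * l e ^ j) (sc (r e) e))"
    unfolding pow by (simp add: scale_sum_right mult.assoc)
  also have "\<dots> = (\<Sum>e\<in>t. \<Sum>j\<le>degree p. sc (coeff p j * l e ^ j) (sc (r e) e))"
    by (rule sum.swap)
  also have "\<dots> = (\<Sum>e\<in>t. sc (poly p (l e)) (sc (r e) e))"
    by (simp add: poly_altdef scale_sum_left sum_distrib_right)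
  also have "\<dots> = 0"
  proof (rule sum.neutral, rule ballI)
    fix e assume e: "e \<in> t"
    have "poly p (l e) = 0" unfolding p_def poly_prod using t(1) e by (auto simp: prod_zero_iff)
    then show "sc (poly p (l e)) (sc (r e) e) = 0" by simp
  qed
  finally have "sc (poly p \<mu>) x = 0" .
  moreover have "poly p \<mu> \<noteq> 0"
    unfolding p_def poly_prod using t l by (auto simp: prod_zero_iff)
  ultimately show ?thesis by simp
qed

end

definition neg_word :: "gen set \<Rightarrow> gen list \<Rightarrow> bool" where
  "neg_word G u \<longleftrightarrow> (\<forall>g\<in>set u. g \<in> G \<and> neg_gen g)"

lemma neg_word_Nil [simp]: "neg_word G []"
  and neg_word_Cons [simp]: "neg_word G (g # u) \<longleftrightarrow> g \<in> G \<and> neg_gen g \<and> neg_word G u"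
  and neg_word_append [simp]: "neg_word G (u @ v) \<longleftrightarrow> neg_word G u \<and> neg_word G v"
  by (auto simp: neg_word_def)

lemma neg_word_subset: "neg_word G u \<Longrightarrow> set u \<subseteq> G"
  by (auto simp: neg_word_def)

text \<open>This is U(L^-) P, or U(Vir^-) P when \<open>G\<close> is \<open>Vir_gens\<close>,
  spelled out by words.\<close>

definition neg_span :: "gen set \<Rightarrow> (complex \<Rightarrow> 'v::ab_group_add \<Rightarrow> 'v) \<Rightarrow> (gen \<Rightarrow> 'v \<Rightarrow> 'v)
    \<Rightarrow> 'v set \<Rightarrow> 'v set" where
  "neg_span G sc act P = module.span sc {wact act u p | u p. neg_word G u \<and> p \<in> P}"

lemma neg_gen_simps [simp]:
  "neg_gen (D n) \<longleftrightarrow> n < 0" "neg_gen (J n) \<longleftrightarrow> n < 0" "\<not> neg_gen Z1" "\<not> neg_gen Z2" "\<not> neg_gen Z3"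
  by (auto simp: neg_gen_def)

lemma deg_neg_word: "neg_word G u \<Longrightarrow> u \<noteq> [] \<Longrightarrow> deg u < 0"
proof (induction u)
  case (Cons g u)
  then show ?case by (cases g; cases u) auto
qed simp

lemma deg_neg_word_le: "neg_word G u \<Longrightarrow> deg u \<le> 0"
  using deg_neg_word[of G u] by (cases u) auto

text \<open>In the intended uses chi vanishes on the generators of positive degree.\<close>
definition hwv :: "gen set \<Rightarrow> (complex \<Rightarrow> 'v::ab_group_add \<Rightarrow> 'v) \<Rightarrow> 'v set \<Rightarrow> (gen \<Rightarrow> 'v \<Rightarrow> 'v)
    \<Rightarrow> (gen \<Rightarrow> complex) \<Rightarrow> 'v \<Rightarrow> bool" where
  "hwv G sc C act \<chi> w \<longleftrightarrow> w \<in> C \<and> w \<noteq> 0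
     \<and> (\<forall>g\<in>G. \<not> neg_gen g \<longrightarrow> act g w = sc (\<chi> g) w)"

text \<open>An arbitrary \<open>G\<close> need not span a subalgebra. The two cases guarantee that
  brackets stay in \<open>G\<close> and that d_0 is available for weight arguments.\<close>

locale lie_rep = rep_space +
  assumes G_cases: "G = UNIV \<or> G = Vir_gens"
begin

lemma br_in: "g \<in> G \<Longrightarrow> h \<in> G \<Longrightarrow> (c, k) \<in> set (br g h) \<Longrightarrow> k \<in> G"
  using G_cases by (cases g; cases h) (auto simp: Vir_gens_def split: if_splits)

lemma D_in: "D n \<in> G"
  using G_cases by (auto simp: Vir_gens_def)

text \<open>A generator that is not negative is commuted to the right until it meets
  \<open>P\<close>. Each commutator is a single generator applied to a shorter word, so induction on
  the word works once the acting generator is arbitrary.\<close>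

lemma neg_span_submodule:
  assumes P: "P \<subseteq> C"
    and nonneg: "\<And>g p. g \<in> G \<Longrightarrow> \<not> neg_gen g \<Longrightarrow> p \<in> P \<Longrightarrow> act g p \<in> neg_span G sc act P"
  shows "submodule G sc C act (neg_span G sc act P)"
proof -
  let ?W = "{wact act u p | u p. neg_word G u \<and> p \<in> P}"
  have WC: "?W \<subseteq> C" using P wact_in neg_word_subset by blast
  have sub: "subspace (neg_span G sc act P)" by (simp add: neg_span_def)
  have base: "wact act u p \<in> neg_span G sc act P" if "neg_word G u" "p \<in> P" for u p
    using that unfolding neg_span_def by (intro span_base) blast
  have neg: "act h x \<in> neg_span G sc act P"
    if "h \<in> G" "neg_gen h" "x \<in> neg_span G sc act P" for h x
  proof (rule act_span[OF that(1) WC sub])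
    show "x \<in> span ?W" using that(3) by (simp add: neg_span_def)
    fix e assume "e \<in> ?W"
    then obtain u p where "e = wact act u p" "neg_word G u" "p \<in> P" by blast
    then show "act h e \<in> neg_span G sc act P" using base[of "h # u" p] that by simp
  qed
  have word: "act g (wact act u p) \<in> neg_span G sc act P"
    if "g \<in> G" "neg_word G u" "p \<in> P" for g u p
    using that
  proof (induction u arbitrary: g)
    case Nil
    then show ?case using base[of "[g]" p] nonneg by (cases "neg_gen g") auto
  next
    case (Cons h u)
    show ?case
    proof (cases "neg_gen g")
      case True
      then show ?thesis using base[of "g # h # u" p] Cons.prems by simp
    next
      case False
      have x: "wact act u p \<in> C" using Cons.prems wact_in neg_word_subset P by auto
      have "act g (act h (wact act u p)) = act h (act g (wact act u p))
          + (\<Sum>(c, k)\<leftarrow>br g h. sc c (act k (wact act u p)))"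
        using Cons.prems x by (intro act_comm) auto
      also have "\<dots> \<in> neg_span G sc act P"
      proof (intro subspace_add[OF sub] sum_list_in_subspace[OF sub])
        show "act h (act g (wact act u p)) \<in> neg_span G sc act P"
          using Cons.prems Cons.IH[of g] by (intro neg[of h]) auto
        show "act k (wact act u p) \<in> neg_span G sc act P" if "(c, k) \<in> set (br g h)" for c k
          using Cons br_in[OF _ _ that] by auto
      qed
      finally show ?thesis by simp
    qed
  qed
  show ?thesis
    unfolding submodule_def
  proof (intro conjI ballI)
    show "neg_span G sc act P \<subseteq> C"
      unfolding neg_span_def using WC subspace_C by (rule span_minimal)
    show "subspace (neg_span G sc act P)" by (rule sub)
    fix g x assume g: "g \<in> G" and x: "x \<in> neg_span G sc act P"
    show "act g x \<in> neg_span G sc act P"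
    proof (rule act_span[OF g WC sub])
      show "x \<in> span ?W" using x by (simp add: neg_span_def)
      fix e assume "e \<in> ?W"
      then show "act g e \<in> neg_span G sc act P" using word[OF g] by blast
    qed
  qed
qed

lemma neg_span_superset: "P \<subseteq> neg_span G sc act P"
proof
  fix p assume "p \<in> P"
  then have "wact act [] p \<in> {wact act u p | u p. neg_word G u \<and> p \<in> P}"
    using neg_word_Nil by blast
  then show "p \<in> neg_span G sc act P"
    unfolding neg_span_def by (simp add: span_base)
qed

lemma hwv_submodule:
  assumes "hwv G sc C act \<chi> w"
  shows "submodule G sc C act (neg_span G sc act {w})"
proof (rule neg_span_submodule)
  show "{w} \<subseteq> C" using assms by (simp add: hwv_def)
  fix g p assume "g \<in> G" "\<not> neg_gen g" "p \<in> {w}"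
  then have "act g p = sc (\<chi> g) w" using assms by (simp add: hwv_def)
  then show "act g p \<in> neg_span G sc act {w}"
    using neg_span_superset[of "{w}"] by (simp add: neg_span_def span_scale)
qed

lemma simple_eq_neg_span:
  assumes "simple_rep G sc C act" "hwv G sc C act \<chi> w"
  shows "C = neg_span G sc act {w}"
  using assms hwv_submodule[OF assms(2)] neg_span_superset[of "{w}"]
  by (auto simp: simple_rep_def hwv_def)

lemma weight_act:
  assumes "x \<in> C" "act (D 0) x = sc \<mu> x" "set u \<subseteq> G"
  shows "act (D 0) (wact act u x) = sc (\<mu> + of_int (deg u)) (wact act u x)"
  using assms(3)
proof (induction u)
  case Nil
  then show ?case using assms by simp
next
  case (Cons g u)
  have y: "wact act u x \<in> C" using Cons.prems assms wact_in by simp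
  have gG: "g \<in> G" using Cons.prems by simp
  have "act (D 0) (act g (wact act u x)) = act g (act (D 0) (wact act u x))
      + (\<Sum>(c, k)\<leftarrow>br (D 0) g. sc c (act k (wact act u x)))"
    using Cons.prems y D_in by (intro act_comm) auto
  also have "act g (act (D 0) (wact act u x)) = sc (\<mu> + of_int (deg u)) (act g (wact act u x))"
    using Cons y gG by (simp add: act_scale)
  \<comment> \<open>Central terms do not disturb the weight: n^3 - n and n^2 + n vanish at n =
    0.\<close>
  also have "(\<Sum>(c, k)\<leftarrow>br (D 0) g. sc c (act k (wact act u x)))
      = sc (of_int (deg [g])) (act g (wact act u x))"
    by (cases g) (auto simp: add.commute)
  finally have "act (D 0) (act g (wact act u x))
      = sc (\<mu> + of_int (deg u) + of_int (deg [g])) (act g (wact act u x))"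
    by (simp add: scale_left_distrib)
  also have "\<mu> + of_int (deg u) + of_int (deg [g]) = \<mu> + of_int (deg (g # u))"
    by (cases g) auto
  finally show ?case by simp
qed

text \<open>Nonempty negative words strictly lower the d_0-weight. After subtraction of a multiple
  of \<open>w\<close>, what remains of \<open>x\<close> is a vector of top weight in the span of
  vectors of lower weight, hence zero.\<close>

lemma top_weight:
  assumes "hwv G sc C act \<chi> w" "x \<in> neg_span G sc act {w}" "act (D 0) x = sc (\<chi> (D 0)) x"
  shows "\<exists>c. x = sc c w"
proof -
  let ?E = "{wact act u w | u. neg_word G u \<and> u \<noteq> []}"
  have w: "w \<in> C" "act (D 0) w = sc (\<chi> (D 0)) w"
    using assms(1) D_in by (auto simp: hwv_def)
  have "{wact act u p | u p. neg_word G u \<and> p \<in> {w}} \<subseteq> insert w ?E"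
  proof
    fix y assume "y \<in> {wact act u p | u p. neg_word G u \<and> p \<in> {w}}"
    then obtain u where "y = wact act u w" "neg_word G u" by blast
    then show "y \<in> insert w ?E" by (cases "u = []") auto
  qed
  then have "x \<in> span (insert w ?E)"
    using assms(2) span_mono unfolding neg_span_def by blast
  then obtain c where c: "x - sc c w \<in> span ?E"
    using span_breakdown_eq by blast
  have xC: "x \<in> C" using assms(2) hwv_submodule[OF assms(1)] by (auto simp: submodule_def)
  have "x - sc c w = 0"
  proof (rule eigenvector_in_span_zero[OF D_in[of 0] _ _ c])
    show "?E \<subseteq> C" using w wact_in neg_word_subset by blast
    show "\<exists>l. l \<noteq> \<chi> (D 0) \<and> act (D 0) e = sc l e" if "e \<in> ?E" for e
    proof -
      from that obtain u where u: "e = wact act u w" "neg_word G u" "u \<noteq> []" by blast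
      have "\<chi> (D 0) + of_int (deg u) \<noteq> \<chi> (D 0)" using deg_neg_word[OF u(2,3)] by simp
      then show ?thesis using weight_act[OF w neg_word_subset[OF u(2)]] u(1) by blast
    qed
    show "act (D 0) (x - sc c w) = sc (\<chi> (D 0)) (x - sc c w)"
      using assms(3) w xC D_in
      by (simp add: act_diff scale_in act_scale scale_right_diff_distrib mult.commute)
  qed
  then show ?thesis by auto
qed

lemma hwv_generates:
  assumes "submodule G sc C act S" "w \<in> S" "C = neg_span G sc act {w}"
  shows "S = C"
proof -
  have "wact act u w \<in> S" if "set u \<subseteq> G" for u
    using that assms by (induction u) (auto simp: submodule_def)
  then have "{wact act u p | u p. neg_word G u \<and> p \<in> {w}} \<subseteq> S"
    using neg_word_subset by blast
  then have "C \<subseteq> S"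
    using assms span_minimal unfolding neg_span_def submodule_def by blast
  then show ?thesis using assms(1) by (auto simp: submodule_def)
qed

end

section \<open>Homomorphisms out of highest weight modules\<close>

definition rep_hom :: "gen set \<Rightarrow> (complex \<Rightarrow> 'v::ab_group_add \<Rightarrow> 'v) \<Rightarrow> 'v set \<Rightarrow> (gen \<Rightarrow> 'v \<Rightarrow> 'v)
    \<Rightarrow> (complex \<Rightarrow> 'w::ab_group_add \<Rightarrow> 'w) \<Rightarrow> 'w set \<Rightarrow> (gen \<Rightarrow> 'w \<Rightarrow> 'w) \<Rightarrow> ('v \<Rightarrow> 'w) \<Rightarrow> bool" where
  "rep_hom G sc C act sc' C' act' \<phi> \<longleftrightarrow> (\<forall>x\<in>C. \<phi> x \<in> C')
     \<and> (\<forall>x\<in>C. \<forall>y\<in>C. \<phi> (x + y) = \<phi> x + \<phi> y) \<and> (\<forall>c. \<forall>x\<in>C. \<phi> (sc c x) = sc' c (\<phi> x))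
     \<and> (\<forall>g\<in>G. \<forall>x\<in>C. \<phi> (act g x) = act' g (\<phi> x))"

lemma sum_list_pair:
  "(\<Sum>(c, k)\<leftarrow>l. (f c k, g c k)) = ((\<Sum>(c, k)\<leftarrow>l. f c k), (\<Sum>(c, k)\<leftarrow>l. g c k))"
  by (induction l) (auto simp: zero_prod_def)

lemma is_rep_Times:
  assumes "is_rep G sc C act" "is_rep G sc' C' act'"
  shows "is_rep G (\<lambda>c p. (sc c (fst p), sc' c (snd p))) (C \<times> C')
    (\<lambda>g p. (act g (fst p), act' g (snd p)))"
proof -
  interpret A: rep_space G sc C act using assms(1) by unfold_locales
  interpret B: rep_space G sc' C' act' using assms(2) by unfold_locales
  let ?sc = "\<lambda>c p. (sc c (fst p), sc' c (snd p))"
  have vs: "vector_space ?sc"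
    by unfold_locales
      (auto simp: A.scale_right_distrib A.scale_left_distrib B.scale_right_distrib
        B.scale_left_distrib)
  then interpret V: vector_space ?sc .
  have "V.subspace (C \<times> C')"
    unfolding V.subspace_def using A.subspace_C B.subspace_C
    by (auto simp: A.subspace_def B.subspace_def zero_prod_def)
  moreover have "act g (act h x) - act h (act g x) = (\<Sum>(c, k)\<leftarrow>br g h. sc c (act k x))"
    "act' g (act' h y) - act' h (act' g y) = (\<Sum>(c, k)\<leftarrow>br g h. sc' c (act' k y))"
    if "g \<in> G" "h \<in> G" "x \<in> C" "y \<in> C'" for g h x y
    using A.act_comm[of g h x] B.act_comm[of g h y] that by simp_all
  ultimately show ?thesis
    using vs unfolding is_rep_def
    by (auto simp: A.act_in B.act_in A.act_add B.act_add A.act_scale B.act_scale sum_list_pair)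
qed

text \<open>The submodule generated by (w, w') in the direct sum is the graph of the homomorphism: its
  intersection with 0 + C' is a proper submodule of C' because the highest weight space of the graph
  is spanned by (w, w').\<close>
lemma hw_quotient_map:
  assumes A: "lie_rep G sc C act" "hwv G sc C act \<chi> w" "C = neg_span G sc act {w}"
    and B: "lie_rep G sc' C' act'" "hwv G sc' C' act' \<chi> w'" "simple_rep G sc' C' act'"
  shows "\<exists>\<phi>. rep_hom G sc C act sc' C' act' \<phi> \<and> \<phi> w = w' \<and> \<phi> ` C = C'"
proof -
  interpret A: lie_rep G sc C act by (rule A)
  interpret B: lie_rep G sc' C' act' by (rule B)
  let ?sc = "\<lambda>c p. (sc c (fst p), sc' c (snd p))"
  let ?act = "\<lambda>g p. (act g (fst p), act' g (snd p))"
  interpret P: lie_rep G ?sc "C \<times> C'" ?act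
    by unfold_locales (simp_all add: is_rep_Times A.rep B.rep A.G_cases)
  have w: "w \<in> C" "w \<noteq> 0" "w' \<in> C'" "w' \<noteq> 0" using A(2) B(2) by (auto simp: hwv_def)
  have hw: "hwv G ?sc (C \<times> C') ?act \<chi> (w, w')"
    using A(2) B(2) by (auto simp: hwv_def zero_prod_def)
  define R where "R = neg_span G ?sc ?act {(w, w')}"
  have R: "submodule G ?sc (C \<times> C') ?act R"
    unfolding R_def by (rule P.hwv_submodule[OF hw])
  have Rs: "P.subspace R" using R by (simp add: submodule_def)
  have RC: "x \<in> C \<and> y \<in> C'" if "(x, y) \<in> R" for x y using R that by (auto simp: submodule_def)
  have R0: "(0, 0) \<in> R" using P.subspace_0[OF Rs] by (simp add: zero_prod_def)
  have Radd: "(x + x', y + y') \<in> R" if "(x, y) \<in> R" "(x', y') \<in> R" for x y x' y'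
    using P.subspace_add[OF Rs that] by simp
  have Rsc: "(sc c x, sc' c y) \<in> R" if "(x, y) \<in> R" for x y c
    using P.subspace_scale[OF Rs that] by simp
  have Ract: "(act g x, act' g y) \<in> R" if "(x, y) \<in> R" "g \<in> G" for x y g
    using R that unfolding submodule_def by fastforce
  have Rw: "(w, w') \<in> R" using P.neg_span_superset[of "{(w, w')}"] by (simp add: R_def)
  have "submodule G sc' C' act' {y. (0, y) \<in> R}"
  proof (rule B.submoduleI)
    show "x + y \<in> {y. (0, y) \<in> R}" if "x \<in> {y. (0, y) \<in> R}" "y \<in> {y. (0, y) \<in> R}" for x y
      using Radd[of 0 x 0 y] that by simp
    show "sc' c x \<in> {y. (0, y) \<in> R}" if "x \<in> {y. (0, y) \<in> R}" for c x
      using Rsc[of 0 x c] that by simp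
    show "act' g x \<in> {y. (0, y) \<in> R}" if "g \<in> G" "x \<in> {y. (0, y) \<in> R}" for g x
      using Ract[of 0 x g] that by (simp add: A.act_zero)
  qed (use RC R0 in auto)
  moreover have "(0, w') \<notin> R"
  proof
    assume *: "(0, w') \<in> R"
    have "\<exists>c. (0, w') = ?sc c (w, w')"
    proof (rule P.top_weight[OF hw])
      show "(0, w') \<in> neg_span G ?sc ?act {(w, w')}" using * by (simp add: R_def)
      show "?act (D 0) (0, w') = ?sc (\<chi> (D 0)) (0, w')"
        using B(2) A.D_in by (auto simp: hwv_def A.act_zero)
    qed
    then show False using w by auto
  qed
  ultimately have fun0: "y = 0" if "(0, y) \<in> R" for y
    using B(3) w that unfolding simple_rep_def by blast
  have unique: "y = y'" if "(x, y) \<in> R" "(x, y') \<in> R" for x y y'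
    using fun0[of "y - y'"] Radd[OF that(1) Rsc[OF that(2), of "- 1"]] by simp
  have "submodule G sc' C' act' {y. \<exists>x. (x, y) \<in> R}"
    by (rule B.submoduleI) (use RC R0 Radd Rsc Ract in blast)+
  then have surj: "{y. \<exists>x. (x, y) \<in> R} = C'"
    using B(3) w Rw unfolding simple_rep_def by blast
  \<comment> \<open>The domain is all of \<open>C\<close> because \<open>w\<close> generates it; the
    source is not assumed simple, since it will be a Verma module.\<close>
  have "submodule G sc C act {x. \<exists>y. (x, y) \<in> R}"
    by (rule A.submoduleI) (use RC R0 Radd Rsc Ract in blast)+
  then have dom: "{x. \<exists>y. (x, y) \<in> R} = C"
    using Rw A(3) by (intro A.hwv_generates) blast+
  define \<phi> where "\<phi> x = (THE y. (x, y) \<in> R)" for x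
  have eq: "\<phi> x = y" if "(x, y) \<in> R" for x y
    unfolding \<phi>_def using that unique by blast
  have graph: "(x, \<phi> x) \<in> R" if "x \<in> C" for x
    using dom that eq by blast
  show ?thesis
  proof (intro exI conjI)
    show "rep_hom G sc C act sc' C' act' \<phi>"
      unfolding rep_hom_def using graph RC by (auto intro!: eq Radd Rsc Ract)
    show "\<phi> w = w'" by (rule eq[OF Rw])
    show "\<phi> ` C = C'"
    proof (intro equalityI subsetI)
      show "y \<in> C'" if "y \<in> \<phi> ` C" for y using that graph RC by blast
      show "y \<in> \<phi> ` C" if "y \<in> C'" for y
      proof -
        from that obtain x where "(x, y) \<in> R" using surj by blast
        then show ?thesis using RC eq by force
      qed
    qed
  qed
qed

fun hw_fun :: "complex \<Rightarrow> complex \<Rightarrow> complex \<Rightarrow> complex \<Rightarrow> complex \<Rightarrow> gen \<Rightarrow> complex" where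
  "hw_fun I0 d0 z1 z2 z3 (D n) = (if n = 0 then d0 else 0)"
| "hw_fun I0 d0 z1 z2 z3 (J n) = (if n = 0 then I0 else 0)"
| "hw_fun I0 d0 z1 z2 z3 Z1 = z1"
| "hw_fun I0 d0 z1 z2 z3 Z2 = z2"
| "hw_fun I0 d0 z1 z2 z3 Z3 = z3"

lemma is_hw_L_hwv:
  assumes "vector_space sc" "is_hw_L sc C act I0 d0 z1 z2 z3 w"
  shows "hwv UNIV sc C act (hw_fun I0 d0 z1 z2 z3) w"
proof -
  interpret vector_space sc by (rule assms)
  have "act g w = sc (hw_fun I0 d0 z1 z2 z3 g) w" if "\<not> neg_gen g" for g
    using assms(2) that by (cases g) (auto simp: is_hw_L_def)
  then show ?thesis using assms(2) by (auto simp: hwv_def is_hw_L_def)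
qed

lemma is_hw_Vir_hwv:
  assumes "vector_space sc" "is_hw_Vir sc C act h c w"
  shows "hwv Vir_gens sc C act (hw_fun 0 h c 0 0) w"
proof -
  interpret vector_space sc by (rule assms)
  have "act g w = sc (hw_fun 0 h c 0 0 g) w" if "g \<in> Vir_gens" "\<not> neg_gen g" for g
    using assms(2) that by (cases g) (auto simp: is_hw_Vir_def Vir_gens_def)
  then show ?thesis using assms(2) by (auto simp: hwv_def is_hw_Vir_def)
qed

section \<open>Consequences of simplicity: local nilpotency and the vanishing of I_n\<close>

context lie_rep
begin

text \<open>A singular vector of weight different from the highest one generates a proper submodule.\<close>
lemma singular_zero:
  assumes simple: "simple_rep G sc C act" and w: "hwv G sc C act \<chi> w"
    and x: "x \<in> C" "\<And>g. g \<in> G \<Longrightarrow> \<not> neg_gen g \<Longrightarrow> act g x = sc (\<psi> g) x"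
    and wt: "\<psi> (D 0) = \<chi> (D 0) - of_nat k" "k \<noteq> 0"
  shows "x = 0"
proof (rule ccontr)
  assume "x \<noteq> 0"
  then have hx: "hwv G sc C act \<psi> x" using x by (auto simp: hwv_def)
  have C: "C = neg_span G sc act {x}" by (rule simple_eq_neg_span[OF simple hx])
  have ww: "w \<in> C" "w \<noteq> 0" "act (D 0) w = sc (\<chi> (D 0)) w"
    using w D_in by (auto simp: hwv_def)
  have Dx: "act (D 0) x = sc (\<psi> (D 0)) x" using x D_in by simp
  \<comment> \<open>The weights of U(L^-) x are \<open>\<psi> (D 0) + deg u\<close> with
    \<open>deg u \<le> 0\<close>, so all lie strictly below the weight of \<open>w\<close>, although
    \<open>w\<close> is in this span.\<close>
  have "w = 0"
  proof (rule eigenvector_in_span_zero[OF D_in[of 0] _ _ _ ww(3)])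
    show "w \<in> span {wact act u p | u p. neg_word G u \<and> p \<in> {x}}"
      using ww C by (simp add: neg_span_def)
    show "{wact act u p | u p. neg_word G u \<and> p \<in> {x}} \<subseteq> C"
      using x wact_in neg_word_subset by blast
    fix e assume "e \<in> {wact act u p | u p. neg_word G u \<and> p \<in> {x}}"
    then obtain u where u: "e = wact act u x" "neg_word G u" by blast
    have "complex_of_int (deg u) \<noteq> of_int (int k)"
      unfolding of_int_eq_iff using deg_neg_word_le[OF u(2)] wt(2) by simp
    then have "\<psi> (D 0) + of_int (deg u) \<noteq> \<chi> (D 0)"
      unfolding wt by (auto simp: algebra_simps)
    then show "\<exists>l. l \<noteq> \<chi> (D 0) \<and> act (D 0) e = sc l e"
      using weight_act[OF x(1) Dx neg_word_subset[OF u(2)]] u(1) by blast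
  qed
  then show False using ww by simp
qed

end

text \<open>When n exceeds the absolute value of the degree of \<open>g\<close>, the total degree is
  not zero and no central term can appear.\<close>

lemma br_high_degree:
  assumes "\<bar>deg [g]\<bar> < n" "h = D n \<or> h = J n" "(c, k) \<in> set (br h g)"
  shows "k = D (n + deg [g]) \<or> k = J (n + deg [g])"
  using assms by (cases g) (auto simp: add.commute)

context
  fixes sc :: "complex \<Rightarrow> 'v::ab_group_add \<Rightarrow> 'v" and C act I0 d0 z1 z2 z3
  assumes V: "is_V_L sc C act I0 d0 z1 z2 z3"
begin

interpretation lie_rep UNIV sc C act
  using V by unfold_locales (simp_all add: is_V_L_def)

text \<open>The vectors killed by d_n and I_n for all large n form a submodule, because commuting
  past \<open>g\<close> only shifts n by the degree of \<open>g\<close>. It contains the highest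
  weight vector, so by simplicity it is everything.\<close>

lemma locally_nilpotent:
  assumes "v \<in> C"
  shows "\<exists>N. \<forall>n\<ge>N. act (D n) v = 0 \<and> act (J n) v = 0"
proof -
  let ?S = "{v\<in>C. \<exists>N. \<forall>n\<ge>N. act (D n) v = 0 \<and> act (J n) v = 0}"
  have "submodule UNIV sc C act ?S"
  proof (rule submoduleI)
    show "0 \<in> ?S" by (simp add: zero_in act_zero)
    fix x assume x: "x \<in> ?S"
    then obtain N where N: "\<And>n. n \<ge> N \<Longrightarrow> act (D n) x = 0 \<and> act (J n) x = 0" by auto
    show "sc c x \<in> ?S" for c
      using x N by (auto simp: scale_in act_scale intro!: exI[of _ N])
    show "x + y \<in> ?S" if y: "y \<in> ?S" for y
    proof -
      obtain N' where "\<And>n. n \<ge> N' \<Longrightarrow> act (D n) y = 0 \<and> act (J n) y = 0" using y by auto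
      then show ?thesis using x y N
        by (auto simp: add_in act_add intro!: exI[of _ "max N N'"])
    qed
    show "act g x \<in> ?S" for g
    proof -
      let ?d = "\<bar>deg [g]\<bar>"
      \<comment> \<open>The bound serves three ends: n exceeds \<open>?d\<close>, which excludes
        central terms, and both n and n + deg g are at least \<open>N\<close>.\<close>
      have "act (D n) (act g x) = 0 \<and> act (J n) (act g x) = 0" if n: "n \<ge> \<bar>N\<bar> + ?d + 1" for n
      proof -
        have xC: "x \<in> C" using x by simp
        have high: "?d < n" "n \<ge> N" "n + deg [g] \<ge> N" using n by linarith+
        have "act h (act g x) = 0" if h: "h = D n \<or> h = J n" for h
        proof -
          have "(\<Sum>(c, k)\<leftarrow>br h g. sc c (act k x)) \<in> {0}"
            using br_high_degree[OF high(1) h] N[OF high(3)]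
            by (intro sum_list_in_subspace) auto
          moreover have "act h x = 0" using N[OF high(2)] h by auto
          ultimately show ?thesis using act_comm[of h g x] xC by (simp add: act_zero)
        qed
        then show ?thesis by blast
      qed
      then show ?thesis using x by (auto simp: act_in intro!: exI[of _ "\<bar>N\<bar> + ?d + 1"])
    qed
  qed auto
  moreover obtain w where "is_hw_L sc C act I0 d0 z1 z2 z3 w" using V by (auto simp: is_V_L_def)
  then have "w \<in> ?S" "w \<noteq> 0" by (auto simp: is_hw_L_def intro!: exI[of _ 1])
  ultimately have "?S = C" using V unfolding is_V_L_def simple_rep_def by blast
  then show ?thesis using assms by blast
qed

end

text \<open>By strong induction on k, I_(-k) w is singular: d_n with n > 0 sends it to a multiple of
  I_(n-k) w plus a multiple of z_2 w, both zero, and I_n sends it to a multiple of z_3 w = 0. A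
  singular vector of lower weight vanishes in a simple module.\<close>

lemma J_act_zero:
  assumes V: "is_V_L sc C act 0 d0 z1 0 0"
  shows "v \<in> C \<Longrightarrow> act (J n) v = 0" "v \<in> C \<Longrightarrow> act Z2 v = 0" "v \<in> C \<Longrightarrow> act Z3 v = 0"
proof -
  interpret lie_rep UNIV sc C act
    using V by unfold_locales (simp_all add: is_V_L_def)
  have simple: "simple_rep UNIV sc C act" using V by (simp add: is_V_L_def)
  define \<chi> where "\<chi> = hw_fun 0 d0 z1 0 0"
  have wt: "\<And>n. \<chi> (J n) = 0" "\<chi> Z2 = 0" "\<chi> Z3 = 0"
    "\<And>n. n > 0 \<Longrightarrow> \<chi> (D n) = 0" "\<chi> (D 0) = d0" "\<chi> Z1 = z1"
    by (simp_all add: \<chi>_def)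
  obtain w where hw: "hwv UNIV sc C act \<chi> w"
    using V is_hw_L_hwv[OF vector_space_axioms] unfolding is_V_L_def \<chi>_def by blast
  have w: "w \<in> C" "w \<noteq> 0" "\<And>g. \<not> neg_gen g \<Longrightarrow> act g w = sc (\<chi> g) w"
    using hw by (auto simp: hwv_def)
  have Jneg: "act (J (- int k)) w = 0" for k
  proof (induction k rule: less_induct)
    case (less k)
    show ?case
    proof (cases "k = 0")
      case True
      then show ?thesis using w wt by simp
    next
      case False
      let ?x = "act (J (- int k)) w"
      \<comment> \<open>Only the d_0-eigenvalue changes: I_(-k) lowers it by k.\<close>
      let ?\<psi> = "\<lambda>g. if g = D 0 then d0 - of_nat k else \<chi> g"
      show ?thesis
      proof (rule singular_zero[OF simple hw, of _ ?\<psi> k])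
        show "?x \<in> C" using w act_in by simp
        show "?\<psi> (D 0) = \<chi> (D 0) - of_nat k" "k \<noteq> 0" using wt False by auto
        fix g assume g: "\<not> neg_gen g"
        have comm: "act g ?x = act (J (- int k)) (sc (\<chi> g) w)
            + (\<Sum>(c, h)\<leftarrow>br g (J (- int k)). sc c (act h w))"
          using act_comm[of g "J (- int k)" w] w g by simp
        have lin: "act (J (- int k)) (sc c w) = sc c ?x" for c using w by (simp add: act_scale)
        show "act g ?x = sc (?\<psi> g) ?x"
        proof (cases g)
          case (D n)
          have "n \<ge> 0" using g D by simp
          consider "n = 0" | "n > 0" "n < int k" | "n = int k" | "n > int k" 
            using \<open>n \<ge> 0\<close> by linarith
          then show ?thesis
          proof cases
            case 1
            then show ?thesis using comm False D wt(5)
              by (simp add: lin scale_left_diff_distrib)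
          next
            case 2
            have "act (J (- int k + n)) w = 0"
              using less[of "nat (int k - n)"] 2 by (simp add: algebra_simps)
            moreover have "n \<noteq> int k" "\<chi> (D n) = 0" "g \<noteq> D 0" using 2 wt D by auto
            ultimately show ?thesis using comm unfolding D by (simp add: lin act_zero)
          next
            case 3
            have "\<chi> (D n) = 0" "g \<noteq> D 0" using 3 wt D False by auto
            then show ?thesis using comm 3 wt(1)[of 0] wt(2) w(3)[of "J 0"] w(3)[of Z2]
              unfolding D by (simp add: lin act_zero)
          next
            case 4
            have "\<chi> (D n) = 0" "g \<noteq> D 0" "act (J (- int k + n)) w = 0" "n \<noteq> int k"
              using 4 wt D w(3)[of "J (- int k + n)"] by auto
            then show ?thesis using comm unfolding D by (simp add: lin act_zero)
          qed
        next
          case (J n)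
          then show ?thesis using comm g wt w by (auto simp: lin act_zero)
        qed (use comm wt in \<open>auto simp: lin act_zero\<close>)
      qed
    qed
  qed
  have Jw: "act (J n) w = 0" for n
    using Jneg[of "nat (- n)"] w(3)[of "J n"] wt(1) by (cases "n < 0") auto
  \<comment> \<open>The elements I_n, z_2, z_3 span an ideal of L, so their common kernel is a
    submodule; it contains \<open>w\<close>.\<close>
  let ?S = "{v\<in>C. (\<forall>n. act (J n) v = 0) \<and> act Z2 v = 0 \<and> act Z3 v = 0}"
  have "submodule UNIV sc C act ?S"
  proof (rule submoduleI)
    fix g x assume x: "x \<in> ?S"
    have "act h (act g x) = 0" if "h = J n \<or> h = Z2 \<or> h = Z3" for h n
    proof -
      have "(\<Sum>(c, k)\<leftarrow>br h g. sc c (act k x)) = 0"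
        using x that by (cases g) auto
      moreover have "act h x = 0" using x that by auto
      ultimately show ?thesis using act_comm[of h g x] x by (simp add: act_zero)
    qed
    then show "act g x \<in> ?S" using x by (auto simp: act_in)
  qed (auto simp: zero_in add_in scale_in act_zero act_add act_scale)
  moreover have "w \<in> ?S" using w Jw wt by auto
  ultimately have "?S = C" using simple w(2) unfolding simple_rep_def by blast
  then show "v \<in> C \<Longrightarrow> act (J n) v = 0" "v \<in> C \<Longrightarrow> act Z2 v = 0" "v \<in> C \<Longrightarrow> act Z3 v = 0"
    by blast+
qed

section \<open>The functionals on U(L^-)\<close>

lemma br_neg_gen:
  "neg_gen g \<Longrightarrow> neg_gen h \<Longrightarrow> (c, k) \<in> set (br g h) \<Longrightarrow> neg_gen k"
  by (cases g; cases h) (auto split: if_splits)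

lemma neg_word_sort_key: "neg_word G (sort_key f u) \<longleftrightarrow> neg_word G u"
  by (simp add: neg_word_def)

text \<open>The spanning half of the Poincare-Birkhoff-Witt theorem, for an arbitrary family indexed by words
  that satisfies the commutation relations: sorting a word changes its image by images of shorter
  words.\<close>
lemma pbw_straightening:
  fixes s :: "complex \<Rightarrow> 'x::ab_group_add \<Rightarrow> 'x" and \<Phi> :: "gen list \<Rightarrow> 'x"
  assumes "vector_space s"
    and rel: "\<And>v g h u. neg_word UNIV (v @ g # h # u) \<Longrightarrow>
      \<Phi> (v @ g # h # u) = \<Phi> (v @ h # g # u) + (\<Sum>(c, k)\<leftarrow>br g h. s c (\<Phi> (v @ k # u)))"
    and u: "neg_word UNIV u"
  shows "\<Phi> u \<in> module.span s (\<Phi> ` {v. pbw v})"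
proof -
  interpret vector_space s by (rule assms(1))
  define B where "B = span (\<Phi> ` {v. pbw v})"
  have B: "subspace B" by (simp add: B_def)
  have "\<forall>u. length u = n \<longrightarrow> neg_word UNIV u \<longrightarrow> \<Phi> u \<in> B" for n
  proof (induction n rule: less_induct)
    case (less n)
    have swap: "\<Phi> (v @ g # h # u) - \<Phi> (v @ h # g # u) \<in> B"
      if len: "length (v @ g # h # u) = n" and neg: "neg_word UNIV (v @ g # h # u)" for v g h u
    proof -
      have "(\<Sum>(c, k)\<leftarrow>br g h. s c (\<Phi> (v @ k # u))) \<in> B"
      proof -
        have "\<Phi> (v @ k # u) \<in> B" if "(c, k) \<in> set (br g h)" for c k
          using less[of "length (v @ k # u)"] br_neg_gen[OF _ _ that] len neg by auto
        then have "(\<Sum>(c, k)\<leftarrow>l. s c (\<Phi> (v @ k # u))) \<in> B" if "set l \<subseteq> set (br g h)" for l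
          using that by (induction l) (auto simp: subspace_0[OF B] subspace_add[OF B] subspace_scale[OF B])
        then show ?thesis by blast
      qed
      then show ?thesis using rel[OF neg] by simp
    qed
    \<comment> \<open>\<open>ins\<close> and \<open>sort\<close> follow the recursion of insertion
      sort, one adjacent swap at a time. The prefix \<open>v\<close> is arbitrary because the
      recursion works below the leading letters.\<close>
    have ins: "\<Phi> (v @ insort_key pbw_key g u) - \<Phi> (v @ g # u) \<in> B"
      if "length (v @ g # u) = n" "neg_word UNIV (v @ g # u)" for v g u
      using that
    proof (induction u arbitrary: v)
      case Nil
      then show ?case by (simp add: subspace_0[OF B])
    next
      case (Cons h u)
      show ?case
      proof (cases "pbw_key g \<le> pbw_key h")
        case True
        then show ?thesis by (simp add: subspace_0[OF B])
      next
        case False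
        have "\<Phi> ((v @ [h]) @ insort_key pbw_key g u) - \<Phi> ((v @ [h]) @ g # u) \<in> B"
          using Cons by (intro Cons.IH) auto
        moreover have "\<Phi> (v @ h # g # u) - \<Phi> (v @ g # h # u) \<in> B"
          using Cons.prems by (intro swap) auto
        ultimately show ?thesis using False subspace_add[OF B] by fastforce
      qed
    qed
    have sort: "\<Phi> (v @ sort_key pbw_key u) - \<Phi> (v @ u) \<in> B"
      if "length (v @ u) = n" "neg_word UNIV (v @ u)" for v u
      using that
    proof (induction u arbitrary: v)
      case Nil
      then show ?case by (simp add: subspace_0[OF B])
    next
      case (Cons g u)
      have "\<Phi> ((v @ [g]) @ sort_key pbw_key u) - \<Phi> ((v @ [g]) @ u) \<in> B"
        using Cons by (intro Cons.IH) auto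
      moreover have "\<Phi> (v @ insort_key pbw_key g (sort_key pbw_key u))
          - \<Phi> (v @ g # sort_key pbw_key u) \<in> B"
        using Cons.prems by (intro ins) (auto simp: neg_word_sort_key)
      ultimately show ?case using subspace_add[OF B] by fastforce
    qed
    show ?case
    proof (intro allI impI)
      fix u :: "gen list" assume u: "length u = n" "neg_word UNIV u"
      have "pbw (sort_key pbw_key u)" using u by (simp add: pbw_def neg_word_def)
      then have "\<Phi> (sort_key pbw_key u) \<in> B" unfolding B_def by (intro span_base) auto
      moreover have "\<Phi> (sort_key pbw_key u) - \<Phi> u \<in> B" using sort[of "[]" u] u by simp
      ultimately show "\<Phi> u \<in> B" using subspace_diff[OF B] by fastforce
    qed
  qed
  then show ?thesis using u by (simp add: B_def)
qed

context rep_space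
begin

lemma wact_zero: "set u \<subseteq> G \<Longrightarrow> wact act u 0 = 0"
  by (induction u) (auto simp: act_zero)

lemma wact_add: "set u \<subseteq> G \<Longrightarrow> x \<in> C \<Longrightarrow> y \<in> C \<Longrightarrow> wact act u (x + y) = wact act u x + wact act u y"
  by (induction u) (auto simp: act_add wact_in)

lemma wact_scale: "set u \<subseteq> G \<Longrightarrow> x \<in> C \<Longrightarrow> wact act u (sc c x) = sc c (wact act u x)"
  by (induction u) (auto simp: act_scale wact_in)

lemma wact_append: "wact act (u @ v) x = wact act u (wact act v x)"
  by (induction u) auto

lemma fa_act_Nil: "fa_act sc act [] x = 0"
  and fa_act_Cons: "fa_act sc act ((c, u) # Q) x = sc c (wact act u x) + fa_act sc act Q x"
  and fa_act_append: "fa_act sc act (Q @ Q') x = fa_act sc act Q x + fa_act sc act Q' x"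
  by (simp_all add: fa_act_def)

lemma fa_act_smult:
  "fa_act sc act (map (\<lambda>(d, u). (c * d, u)) Q) x = sc c (fa_act sc act Q x)"
  by (induction Q) (auto simp: fa_act_Nil fa_act_Cons scale_right_distrib)

lemma fa_act_in:
  "\<forall>(c, u)\<in>set Q. set u \<subseteq> G \<Longrightarrow> x \<in> C \<Longrightarrow> fa_act sc act Q x \<in> C"
  by (induction Q) (auto simp: fa_act_Nil fa_act_Cons zero_in add_in scale_in wact_in)

lemma wact_fa_act:
  assumes "\<forall>(c, u)\<in>set Q. set u \<subseteq> G" "set v \<subseteq> G" "x \<in> C"
  shows "wact act v (fa_act sc act Q x) = fa_act sc act (map (\<lambda>(c, u). (c, v @ u)) Q) x"
  using assms(1)
proof (induction Q)
  case Nil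
  then show ?case using assms by (simp add: fa_act_Nil wact_zero)
next
  case (Cons p Q)
  obtain c u where p: "p = (c, u)" by force
  show ?case using Cons assms fa_act_in[of Q x] unfolding p
    by (auto simp: fa_act_Cons wact_add wact_scale wact_append wact_in scale_in)
qed

lemma hom_wact:
  assumes "rep_hom G sc C act sc' C' act' \<phi>" "set u \<subseteq> G" "x \<in> C"
  shows "\<phi> (wact act u x) = wact act' u (\<phi> x)"
  using assms(2) by (induction u) (use assms wact_in in \<open>auto simp: rep_hom_def\<close>)

lemma hom_fa_act:
  assumes "rep_hom G sc C act sc' C' act' \<phi>" "\<forall>(c, u)\<in>set Q. set u \<subseteq> G" "x \<in> C" "rep_space G sc' C' act'"
  shows "\<phi> (fa_act sc act Q x) = fa_act sc' act' Q (\<phi> x)"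
  using assms(2)
proof (induction Q)
  case Nil
  interpret B: rep_space G sc' C' act' by (rule assms)
  have "\<phi> (sc 0 0) = sc' 0 (\<phi> 0)" using assms(1) zero_in unfolding rep_hom_def by blast
  then show ?case by (simp add: fa_act_def)
next
  case (Cons p Q)
  obtain c u where p: "p = (c, u)" by force
  interpret B: rep_space G sc' C' act' by (rule assms)
  have "wact act u x \<in> C" "fa_act sc act Q x \<in> C"
    using Cons.prems assms(3) p wact_in fa_act_in by auto
  then show ?case using Cons assms hom_wact[OF assms(1) _ assms(3), of u] unfolding p
    by (auto simp: fa_act_Cons B.fa_act_Cons rep_hom_def scale_in)
qed

end

lemma is_VermaD:
  assumes "is_Verma sc C act I0 d0 z1 z2 z3 w"
  shows "is_rep UNIV sc C act" "is_hw_L sc C act I0 d0 z1 z2 z3 w"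
  using assms unfolding is_Verma_def by blast+

text \<open>The values of f extend to a linear functional on U(L^-) as soon as f respects the commutation
  relations; the Verma module is free of rank one over U(L^-).\<close>
lemma Verma_functional:
  fixes f :: "gen list \<Rightarrow> complex"
  assumes M: "is_Verma sc C act I0 d0 z1 z2 z3 w"
    and rel: "\<And>v g h u. neg_word UNIV (v @ g # h # u) \<Longrightarrow>
      f (v @ g # h # u) = f (v @ h # g # u) + (\<Sum>(c, k)\<leftarrow>br g h. c * f (v @ k # u))"
    and Q: "\<forall>(c, u)\<in>set Q. neg_word UNIV u" "fa_act sc act Q w = 0"
  shows "(\<Sum>(c, u)\<leftarrow>Q. c * f u) = 0"
proof -
  interpret rep_space UNIV sc C act using is_VermaD[OF M] by unfold_locales
  have w: "w \<in> C" using M by (auto simp: is_Verma_def is_hw_L_def)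
  let ?s = "\<lambda>c (p :: 'a \<times> complex). (sc c (fst p), c * snd p)"
  interpret P: vector_space ?s
    by unfold_locales (auto simp: scale_right_distrib scale_left_distrib algebra_simps)
  \<comment> \<open>Each word is paired with its value under \<open>f\<close>. Straightening in the
    product space writes the pair of Q w and f(Q) by pairs of PBW words; if Q w = 0, independence of
    the PBW vectors makes all coefficients zero, and so f(Q) = 0.\<close>
  define \<Phi> where "\<Phi> u = (wact act u w, f u)" for u
  have span: "\<Phi> u \<in> P.span (\<Phi> ` {v. pbw v})" if "neg_word UNIV u" for u
  proof (rule pbw_straightening[OF P.vector_space_axioms _ that])
    fix v g h u assume *: "neg_word UNIV (v @ g # h # u)"
    have y: "wact act u w \<in> C" "set v \<subseteq> UNIV" using w wact_in by auto
    have lin: "wact act v (\<Sum>(c, k)\<leftarrow>l. sc c (act k (wact act u w)))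
        = (\<Sum>(c, k)\<leftarrow>l. sc c (wact act (v @ k # u) w)) \<and>
        (\<Sum>(c, k)\<leftarrow>l. sc c (act k (wact act u w))) \<in> C" for l
      using y by (induction l)
        (auto simp: wact_zero wact_add wact_scale wact_append act_in scale_in add_in zero_in)
    have "act g (act h (wact act u w)) = act h (act g (wact act u w))
        + (\<Sum>(c, k)\<leftarrow>br g h. sc c (act k (wact act u w)))"
      by (rule act_comm) (use y in auto)
    then have "wact act (v @ g # h # u) w = wact act (v @ h # g # u) w
        + (\<Sum>(c, k)\<leftarrow>br g h. sc c (wact act (v @ k # u) w))"
      using lin[of "br g h"] y by (simp add: wact_append wact_add act_in)
    then show "\<Phi> (v @ g # h # u) = \<Phi> (v @ h # g # u) + (\<Sum>(c, k)\<leftarrow>br g h. ?s c (\<Phi> (v @ k # u)))"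
      unfolding \<Phi>_def using rel[OF *] by (simp add: sum_list_pair)
  qed
  have "(fa_act sc act Q w, \<Sum>(c, u)\<leftarrow>Q. c * f u) \<in> P.span (\<Phi> ` {v. pbw v})"
    using Q(1)
  proof (induction Q)
    case Nil
    then show ?case using P.span_zero by (simp add: fa_act_Nil zero_prod_def)
  next
    case (Cons p Q)
    obtain c u where p: "p = (c, u)" by force
    have "?s c (\<Phi> u) + (fa_act sc act Q w, \<Sum>(c, u)\<leftarrow>Q. c * f u) \<in> P.span (\<Phi> ` {v. pbw v})"
      using Cons p by (intro P.span_add P.span_scale span) auto
    then show ?case unfolding p by (simp add: fa_act_Cons \<Phi>_def)
  qed
  then obtain t r where t: "finite t" "t \<subseteq> \<Phi> ` {v. pbw v}"
    "(0, \<Sum>(c, u)\<leftarrow>Q. c * f u) = (\<Sum>e\<in>t. ?s (r e) e)"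
    using Q(2) unfolding P.span_explicit by auto
  \<comment> \<open>One PBW word is chosen for each pair in \<open>t\<close>, which turns
    coefficients of vectors into coefficients of words, as the independence clause of
    \<open>is_Verma\<close> requires.\<close>
  obtain W where W: "W \<subseteq> {v. pbw v}" "inj_on \<Phi> W" "t = \<Phi> ` W"
    using t(2) subset_image_inj[of t \<Phi> "{v. pbw v}"] by auto
  have fW: "finite W" using W t(1) finite_imageD by blast
  have "(0, \<Sum>(c, u)\<leftarrow>Q. c * f u) = (\<Sum>v\<in>W. ?s (r (\<Phi> v)) (\<Phi> v))"
    unfolding t(3) W(3) using W(2) by (simp add: sum.reindex)
  also have "\<dots> = (\<Sum>v\<in>W. (sc (r (\<Phi> v)) (wact act v w), r (\<Phi> v) * f v))"
    by (simp add: \<Phi>_def)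
  finally have eq: "(\<Sum>v\<in>W. sc (r (\<Phi> v)) (wact act v w)) = 0"
    "(\<Sum>(c, u)\<leftarrow>Q. c * f u) = (\<Sum>v\<in>W. r (\<Phi> v) * f v)"
    by (simp_all add: sum_prod)
  have "\<forall>v\<in>W. r (\<Phi> v) = 0"
    using M W(1) fW eq(1) unfolding is_Verma_def by (elim conjE allE[of _ W] allE[of _ "r \<circ> \<Phi>"]) auto
  then show ?thesis using eq(2) by simp
qed

lemma deg_append: "deg (u @ v) = deg u + deg v"
proof (induction u)
  case (Cons g u)
  then show ?case by (cases g) auto
qed simp

text \<open>The factor contributed by a leading letter depends on the rest of the word only through
  its degree. Hence an identity among words of equal degree survives multiplication from the
  left.\<close>

lemma rho_Cons:
  assumes "neg_gen g"
  shows "\<exists>t. \<forall>u. deg u = d \<longrightarrow> rho a b F n (g # u) = t * rho a b F n u"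
proof (cases g)
  case (D p)
  show ?thesis
    by (rule exI[of _ "- (a + of_int (- d) + of_int (- p) + of_int n - of_int (- p) * b)"])
      (simp add: D)
next
  case (J p)
  show ?thesis by (rule exI[of _ "- F"]) (simp add: J)
qed (use assms in auto)

lemma sum_list_mult_left:
  "(\<Sum>(c, u)\<leftarrow>Q. t * f c u) = t * (\<Sum>(c, u)\<leftarrow>Q. f c u)" for t :: complex
  by (induction Q) (auto simp: distrib_left)

text \<open>At the front of a word this is a direct computation with the affine factors; two
  negative generators never produce a central term. A prefix multiplies all terms by a common
  factor, since their degrees agree.\<close>

lemma rho_relation:
  assumes "neg_word UNIV (v @ g # h # u)"
  shows "rho a b F n (v @ g # h # u) = rho a b F n (v @ h # g # u)
    + (\<Sum>(c, k)\<leftarrow>br g h. c * rho a b F n (v @ k # u))"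
  using assms
proof (induction v)
  case Nil
  then show ?case by (cases g; cases h) (auto simp: algebra_simps)
next
  case (Cons f v)
  obtain t where t: "\<And>x. deg x = deg (v @ g # h # u) \<Longrightarrow> rho a b F n (f # x) = t * rho a b F n x"
    using rho_Cons[of f "deg (v @ g # h # u)" a b F n] Cons.prems
    by (metis append_Cons neg_word_Cons)
  have d: "deg (v @ h # g # u) = deg (v @ g # h # u)"
    using Cons.prems by (cases g; cases h) (auto simp: deg_append)
  have "(\<Sum>(c, k)\<leftarrow>br g h. c * rho a b F n (f # v @ k # u))
      = t * (\<Sum>(c, k)\<leftarrow>br g h. c * rho a b F n (v @ k # u))"
    using Cons.prems by (cases g; cases h) (auto simp: deg_append t)
  then show ?case using Cons d by (simp add: t algebra_simps)
qed

text \<open>The intended value at u w (x) x^m of the functional that reads off the coefficient of w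
  (x) x^n modulo the image of L^-. That image is graded, so the value is 0 unless m + deg u =
  n.\<close>

definition theta :: "complex \<Rightarrow> complex \<Rightarrow> complex \<Rightarrow> int \<Rightarrow> int \<Rightarrow> gen list \<Rightarrow> complex" where
  "theta a b F n m u = (if deg u = n - m then rho a b F n u else 0)"

text \<open>Swapping and bracketing preserve the degree, so the cut-off keeps or removes all terms
  of the relation together.\<close>

lemma theta_relation:
  assumes "neg_word UNIV (v @ g # h # u)"
  shows "theta a b F n m (v @ g # h # u) = theta a b F n m (v @ h # g # u)
    + (\<Sum>(c, k)\<leftarrow>br g h. c * theta a b F n m (v @ k # u))"
proof (cases "deg (v @ g # h # u) = n - m")
  case True
  have "deg (v @ h # g # u) = n - m"
    using True by (cases g; cases h) (auto simp: deg_append)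
  moreover have "(\<Sum>(c, k)\<leftarrow>br g h. c * theta a b F n m (v @ k # u))
      = (\<Sum>(c, k)\<leftarrow>br g h. c * rho a b F n (v @ k # u))"
    using True assms by (cases g; cases h) (auto simp: deg_append theta_def)
  ultimately show ?thesis using True rho_relation[OF assms] by (simp add: theta_def)
next
  case False
  have "deg (v @ h # g # u) \<noteq> n - m"
    using False by (cases g; cases h) (auto simp: deg_append)
  moreover have "(\<Sum>(c, k)\<leftarrow>br g h. c * theta a b F n m (v @ k # u)) = 0"
    using False assms by (cases g; cases h) (auto simp: deg_append theta_def)
  ultimately show ?thesis using False by (simp add: theta_def)
qed

lemma homog_neg_word: "homog Q \<Longrightarrow> \<forall>(c, u)\<in>set Q. neg_word UNIV u"
  by (auto simp: homog_def neg_word_def)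

text \<open>Homogeneity is what makes the kernel of \<open>rho\<close> behave like a left ideal
  here: a left factor \<open>v\<close> multiplies every term of \<open>Q\<close> by the same number,
  so rho_n(v Q) is a multiple of rho_n(Q).\<close>

lemma theta_left_ideal:
  assumes Q: "homog Q" "rhoQ a b F n Q = 0" and v: "neg_word UNIV v"
  shows "(\<Sum>(c, u)\<leftarrow>Q. c * theta a b F n m (v @ u)) = 0"
proof -
  obtain d where "\<forall>(c, u)\<in>set Q. deg u = d"
    using Q(1) unfolding homog_def by (elim conjE exE)
  then have d: "deg u = d" if "(c, u) \<in> set Q" for c u using that by auto
  have "(\<Sum>(c, u)\<leftarrow>Q. c * rho a b F n (v @ u)) = 0"
    using v
  proof (induction v)
    case Nil
    then show ?case using Q(2) by (simp add: rhoQ_def)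
  next
    case (Cons g v)
    obtain t where t: "\<And>x. deg x = deg v + d \<Longrightarrow> rho a b F n (g # x) = t * rho a b F n x"
      using rho_Cons[of g "deg v + d" a b F n] Cons.prems by (metis neg_word_Cons)
    have "(\<Sum>(c, u)\<leftarrow>Q. c * rho a b F n (g # v @ u)) = (\<Sum>(c, u)\<leftarrow>Q. t * (c * rho a b F n (v @ u)))"
      by (intro arg_cong[of _ _ sum_list] map_cong) (auto simp: t deg_append d)
    also have "\<dots> = t * (\<Sum>(c, u)\<leftarrow>Q. c * rho a b F n (v @ u))"
      by (rule sum_list_mult_left)
    finally show ?case using Cons by simp
  qed
  moreover have "(\<Sum>(c, u)\<leftarrow>Q. c * theta a b F n m (v @ u))
      = (\<Sum>(c, u)\<leftarrow>Q. (if deg v + d = n - m then 1 else 0) * (c * rho a b F n (v @ u)))"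
    by (intro arg_cong[of _ _ sum_list] map_cong) (auto simp: theta_def deg_append d)
  ultimately show ?thesis unfolding sum_list_mult_left by simp
qed

section \<open>The maximal submodule of the Verma module and the relations of V\<close>

definition left_ideal_span :: "(complex \<Rightarrow> 'v::ab_group_add \<Rightarrow> 'v) \<Rightarrow> (gen \<Rightarrow> 'v \<Rightarrow> 'v)
    \<Rightarrow> 'v \<Rightarrow> uelt \<Rightarrow> uelt \<Rightarrow> 'v set" where
  "left_ideal_span sc act w Q1 Q2 =
    module.span sc ({wact act u (fa_act sc act Q1 w) | u. \<forall>g\<in>set u. neg_gen g}
      \<union> {wact act u (fa_act sc act Q2 w) | u. \<forall>g\<in>set u. neg_gen g})"

text \<open>The kernel is a proper submodule, hence inside the maximal one. Conversely the image of
  the maximal submodule is a proper submodule of the simple module \<open>C\<close>, hence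
  zero.\<close>

lemma max_sub_kernel:
  assumes M: "is_Verma scm Cm actm I0 d0 z1 z2 z3 w" "max_sub_gen scm Cm actm w Q1 Q2"
    and V: "is_V_L sc C act I0 d0 z1 z2 z3" and v: "is_hw_L sc C act I0 d0 z1 z2 z3 v"
  shows "\<exists>\<phi>. rep_hom UNIV scm Cm actm sc C act \<phi> \<and> \<phi> w = v
    \<and> left_ideal_span scm actm w Q1 Q2 = {x\<in>Cm. \<phi> x = 0}"
proof -
  interpret M: lie_rep UNIV scm Cm actm using is_VermaD[OF M(1)] by unfold_locales simp_all
  interpret V: lie_rep UNIV sc C act using V by unfold_locales (simp_all add: is_V_L_def)
  let ?\<chi> = "hw_fun I0 d0 z1 z2 z3"
  have hw: "hwv UNIV scm Cm actm ?\<chi> w"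
    using is_hw_L_hwv[OF M.vector_space_axioms is_VermaD(2)[OF M(1)]] .
  have hv: "hwv UNIV sc C act ?\<chi> v" using v is_hw_L_hwv[OF V.vector_space_axioms] by simp
  have w: "w \<in> Cm" and vC: "v \<in> C" "v \<noteq> 0" using hw hv by (auto simp: hwv_def)
  have Cm: "Cm = neg_span UNIV scm actm {w}"
  proof
    have "M.span {wact actm u w | u. pbw u} \<subseteq> neg_span UNIV scm actm {w}"
      unfolding neg_span_def by (rule M.span_mono) (auto simp: pbw_def neg_word_def)
    then show "Cm \<subseteq> neg_span UNIV scm actm {w}" using M(1) by (simp add: is_Verma_def)
    show "neg_span UNIV scm actm {w} \<subseteq> Cm"
      using M.hwv_submodule[OF hw] by (simp add: submodule_def)
  qed
  obtain \<phi> where \<phi>: "rep_hom UNIV scm Cm actm sc C act \<phi>" "\<phi> w = v" "\<phi> ` Cm = C"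
    using hw_quotient_map[OF M.lie_rep_axioms hw Cm V.lie_rep_axioms hv] V
    by (auto simp: is_V_L_def)
  have hom: "x \<in> Cm \<Longrightarrow> y \<in> Cm \<Longrightarrow> \<phi> (x + y) = \<phi> x + \<phi> y"
    "x \<in> Cm \<Longrightarrow> \<phi> (scm c x) = sc c (\<phi> x)" "x \<in> Cm \<Longrightarrow> \<phi> (actm g x) = act g (\<phi> x)" for x y c g
    using \<phi>(1) by (simp_all add: rep_hom_def)
  have \<phi>0: "\<phi> 0 = 0"
    using \<phi>(1) M.zero_in V.scale_zero_left M.scale_zero_left unfolding rep_hom_def by metis
  let ?N = "left_ideal_span scm actm w Q1 Q2" and ?K = "{x\<in>Cm. \<phi> x = 0}"
  have N: "submodule UNIV scm Cm actm ?N" "?N \<noteq> Cm"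
    and max: "\<And>S. submodule UNIV scm Cm actm S \<Longrightarrow> S \<noteq> Cm \<Longrightarrow> S \<subseteq> ?N"
    using M(2) unfolding max_sub_gen_def left_ideal_span_def Let_def by auto
  have NC: "?N \<subseteq> Cm" and Ns: "M.subspace ?N" using N(1) by (auto simp: submodule_def)
  have K: "submodule UNIV scm Cm actm ?K"
    using \<phi>(1) by (intro M.submoduleI)
      (auto simp: \<phi>0 rep_hom_def V.act_zero M.zero_in M.add_in M.scale_in M.act_in)
  moreover have "w \<notin> ?K" using \<phi> vC by simp
  ultimately have KN: "?K \<subseteq> ?N" using max w by blast
  have "submodule UNIV sc C act (\<phi> ` ?N)"
  proof (rule V.submoduleI)
    show "\<phi> ` ?N \<subseteq> C" using NC \<phi>(3) by blast
    show "0 \<in> \<phi> ` ?N" using \<phi>0 M.subspace_0[OF Ns] by force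
    fix x assume "x \<in> \<phi> ` ?N"
    then obtain x' where x: "x' \<in> ?N" "x' \<in> Cm" "x = \<phi> x'" using NC by blast
    show "sc c x \<in> \<phi> ` ?N" for c
      using x hom(2) M.subspace_scale[OF Ns x(1), of c] by (intro image_eqI[of _ _ "scm c x'"]) simp_all
    show "act g x \<in> \<phi> ` ?N" for g
      using x hom(3) N(1) by (intro image_eqI[of _ _ "actm g x'"]) (simp_all add: submodule_def)
    show "x + y \<in> \<phi> ` ?N" if y: "y \<in> \<phi> ` ?N" for y
    proof -
      from y obtain y' where y': "y' \<in> ?N" "y' \<in> Cm" "y = \<phi> y'" using NC by blast
      then show ?thesis
        using x hom(1) M.subspace_add[OF Ns x(1) y'(1)]
        by (intro image_eqI[of _ _ "x' + y'"]) simp_all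
    qed
  qed
  \<comment> \<open>If some x in \<open>?N\<close> were mapped to \<open>v\<close>, then w - x would
    lie in the kernel and so in \<open>?N\<close>; \<open>w\<close> itself would be in
    \<open>?N\<close>, and \<open>?N\<close> would be everything.\<close>
  moreover have "\<phi> ` ?N \<noteq> C"
  proof
    assume "\<phi> ` ?N = C"
    then obtain x where x: "x \<in> ?N" "\<phi> x = v" using vC by force
    have "\<phi> (w + scm (- 1) x) = \<phi> w + sc (- 1) (\<phi> x)"
      using hom(1)[of w "scm (- 1) x"] hom(2)[of x "- 1"] w x NC M.scale_in[of x "- 1"] by auto
    then have "w - x \<in> ?K" using x \<phi> w NC M.subspace_diff[OF M.subspace_C] by auto
    then have "w \<in> ?N" using KN x M.subspace_add[OF Ns, of "w - x" x] by auto
    then show False using M.hwv_generates[OF N(1) _ Cm] N(2) by blast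
  qed
  ultimately have "\<phi> ` ?N = {0}" using V unfolding is_V_L_def simple_rep_def by blast
  then have "?N \<subseteq> ?K" using NC by blast
  then show ?thesis using \<phi> KN by blast
qed

text \<open>The first part gives the relations that move tensors downwards. The second makes
  \<open>theta\<close> well defined on V when rho_n kills both generators: a relation Q v = 0 lifts
  to a vector Q w of the maximal submodule, which is also Q' w for some Q' in the left ideal of Q1
  and Q2, where \<open>theta\<close> vanishes.\<close>

lemma max_sub_relations:
  assumes M: "is_Verma scm Cm actm I0 d0 z1 z2 z3 w" "max_sub_gen scm Cm actm w Q1 Q2"
    and V: "is_V_L sc C act I0 d0 z1 z2 z3" and v: "is_hw_L sc C act I0 d0 z1 z2 z3 v"
    and Q: "homog Q1" "homog Q2"
  shows "fa_act sc act Q1 v = 0 \<and> fa_act sc act Q2 v = 0"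
    and "rhoQ a b F n Q1 = 0 \<Longrightarrow> rhoQ a b F n Q2 = 0 \<Longrightarrow> \<forall>(c, u)\<in>set Q. neg_word UNIV u \<Longrightarrow>
      fa_act sc act Q v = 0 \<Longrightarrow> (\<Sum>(c, u)\<leftarrow>Q. c * theta a b F n m u) = 0"
proof -
  interpret M: lie_rep UNIV scm Cm actm using is_VermaD[OF M(1)] by unfold_locales simp_all
  interpret V: lie_rep UNIV sc C act using V by unfold_locales (simp_all add: is_V_L_def)
  let ?N = "left_ideal_span scm actm w Q1 Q2"
  obtain \<phi> where \<phi>: "rep_hom UNIV scm Cm actm sc C act \<phi>" "\<phi> w = v" "?N = {x\<in>Cm. \<phi> x = 0}"
    using max_sub_kernel[OF M V v] by blast
  have w: "w \<in> Cm" using M(1) by (auto simp: is_Verma_def is_hw_L_def)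
  have fa: "\<phi> (fa_act scm actm Q w) = fa_act sc act Q v" for Q
    using M.hom_fa_act[OF \<phi>(1) _ w V.rep_space_axioms] \<phi>(2) by auto
  have "wact actm [] (fa_act scm actm P w) \<in> ?N" if "P = Q1 \<or> P = Q2" for P
    unfolding left_ideal_span_def
    by (rule M.span_base) (use that in \<open>auto intro!: exI[of _ "[]"] simp del: wact.simps\<close>)
  from this[of Q1] this[of Q2] have "fa_act scm actm Q1 w \<in> ?N" "fa_act scm actm Q2 w \<in> ?N"
    by simp_all
  then show "fa_act sc act Q1 v = 0 \<and> fa_act sc act Q2 v = 0"
    using fa \<phi>(3) by auto
  assume rho: "rhoQ a b F n Q1 = 0" "rhoQ a b F n Q2 = 0"
    and neg: "\<forall>(c, u)\<in>set Q. neg_word UNIV u" and zero: "fa_act sc act Q v = 0"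
  let ?\<theta> = "theta a b F n m"
  have gen: "\<exists>Q'. (\<forall>(c, u)\<in>set Q'. neg_word UNIV u) \<and> fa_act scm actm Q' w = wact actm u (fa_act scm actm P w)
      \<and> (\<Sum>(c, u)\<leftarrow>Q'. c * ?\<theta> u) = 0"
    if "neg_word UNIV u" "homog P" "rhoQ a b F n P = 0" for u P
  proof (intro exI[of _ "map (\<lambda>(c, v). (c, u @ v)) P"] conjI)
    show "\<forall>(c, v)\<in>set (map (\<lambda>(c, v). (c, u @ v)) P). neg_word UNIV v"
      using that(1) homog_neg_word[OF that(2)] by auto
    show "fa_act scm actm (map (\<lambda>(c, v). (c, u @ v)) P) w = wact actm u (fa_act scm actm P w)"
      using M.wact_fa_act[of P u w] w by auto
    show "(\<Sum>(c, u)\<leftarrow>map (\<lambda>(c, v). (c, u @ v)) P. c * ?\<theta> u) = 0"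
      using theta_left_ideal[OF that(2,3,1), of m] by (simp add: case_prod_unfold o_def)
  qed
  have "fa_act scm actm Q w \<in> ?N"
    using \<phi>(3) fa zero M.fa_act_in[of Q w] w by auto
  then have "\<exists>Q'. (\<forall>(c, u)\<in>set Q'. neg_word UNIV u) \<and> fa_act scm actm Q' w = fa_act scm actm Q w
      \<and> (\<Sum>(c, u)\<leftarrow>Q'. c * ?\<theta> u) = 0"
    unfolding left_ideal_span_def
  proof (induction rule: M.span_induct_alt)
    case base
    show ?case by (rule exI[of _ "[]"]) (simp add: M.fa_act_Nil)
  next
    case (step c x y)
    obtain u P where "x = wact actm u (fa_act scm actm P w)" "neg_word UNIV u" "homog P"
      "rhoQ a b F n P = 0"
      using step(1) Q rho by (auto simp: neg_word_def)
    then obtain R where R: "\<forall>(c, u)\<in>set R. neg_word UNIV u" "fa_act scm actm R w = x"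
      "(\<Sum>(c, u)\<leftarrow>R. c * ?\<theta> u) = 0"
      using gen by metis
    from step(2) obtain R' where R': "\<forall>(c, u)\<in>set R'. neg_word UNIV u" "fa_act scm actm R' w = y"
      "(\<Sum>(c, u)\<leftarrow>R'. c * ?\<theta> u) = 0"
      by blast
    have "(\<Sum>(d, u)\<leftarrow>map (\<lambda>(d, u). (c * d, u)) R. d * ?\<theta> u) = c * (\<Sum>(d, u)\<leftarrow>R. d * ?\<theta> u)"
      by (induction R) (auto simp: algebra_simps)
    then show ?case using R R'
      by (intro exI[of _ "map (\<lambda>(d, u). (c * d, u)) R @ R'"])
        (auto simp: M.fa_act_append M.fa_act_smult)
  qed
  then obtain Q' where Q': "\<forall>(c, u)\<in>set Q'. neg_word UNIV u"
    "fa_act scm actm Q' w = fa_act scm actm Q w" "(\<Sum>(c, u)\<leftarrow>Q'. c * ?\<theta> u) = 0"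
    by blast
  \<comment> \<open>Q - Q' annihilates the Verma vector, so \<open>theta\<close> takes the same
    value on Q and Q'.\<close>
  have "(\<Sum>(c, u)\<leftarrow>Q @ map (\<lambda>(d, u). (- 1 * d, u)) Q'. c * ?\<theta> u) = 0"
  proof (rule Verma_functional[OF M(1) theta_relation])
    show "\<forall>(c, u)\<in>set (Q @ map (\<lambda>(d, u). (- 1 * d, u)) Q'). neg_word UNIV u"
      using neg Q'(1) by auto
    show "fa_act scm actm (Q @ map (\<lambda>(d, u). (- 1 * d, u)) Q') w = 0"
      unfolding M.fa_act_append M.fa_act_smult Q'(2) by simp
  qed
  moreover have "(\<Sum>(d, u)\<leftarrow>map (\<lambda>(d, u). (- 1 * d, u)) Q'. d * ?\<theta> u) = - (\<Sum>(d, u)\<leftarrow>Q'. d * ?\<theta> u)"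
    by (induction Q') (auto simp: algebra_simps)
  ultimately show "(\<Sum>(c, u)\<leftarrow>Q. c * ?\<theta> u) = 0" using Q'(3) by simp
qed

section \<open>Tensor products\<close>

text \<open>The structure constants of A(a,b;F): g x^m = \<open>acoef a b F g m\<close> x^(m + deg
  g).\<close>

fun acoef :: "complex \<Rightarrow> complex \<Rightarrow> complex \<Rightarrow> gen \<Rightarrow> int \<Rightarrow> complex" where
  "acoef a b F (D n) m = a + of_int m + of_int n * b"
| "acoef a b F (J n) m = F"
| "acoef a b F _ m = 0"

lemma sum_fun_apply: "(\<Sum>i\<in>I. f i) x = (\<Sum>i\<in>I. f i x)"
  by (induction I rule: infinite_finite_induct) auto

lemma sum_list_fun_apply: "(\<Sum>(c, k)\<leftarrow>l. f c k) x = (\<Sum>(c, k)\<leftarrow>l. f c k x)"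
  by (induction l) auto

text \<open>The condition on M says that the missing basis vectors of A(a,b;F) are those annihilated by
  all of L.\<close>
locale tensor_rep = V: lie_rep UNIV sc C act
  for sc :: "complex \<Rightarrow> 'v::ab_group_add \<Rightarrow> 'v" and C and act :: "gen \<Rightarrow> 'v \<Rightarrow> 'v" +
  fixes a b F :: complex and M :: "int set"
  assumes notin_M: "m \<notin> M \<longleftrightarrow> a + of_int m = 0 \<and> b = 0 \<and> F = 0"
begin

abbreviation "T \<equiv> tens_carrier C M"
abbreviation "ta \<equiv> tens_act sc act a b F M"
abbreviation "ts \<equiv> tsc sc"
abbreviation "co \<equiv> acoef a b F"

lemma co_zero: "m \<notin> M \<Longrightarrow> co g m = 0"
  using notin_M[of m] by (cases g) auto

lemma ta_eq: "ta g f m = (if m \<in> M then act g (f m) + sc (co g (m - deg [g])) (f (m - deg [g])) else 0)"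
  by (cases g) (auto simp: tens_act_def)

text \<open>The truncation at a missing index is invisible once multiplied by \<open>co g m\<close>,
  which vanishes there. Compositions can thus be computed as if nothing had been truncated.\<close>

lemma co_ta: "f \<in> T \<Longrightarrow> sc (co g m) (ta h f m)
    = sc (co g m) (act h (f m) + sc (co h (m - deg [h])) (f (m - deg [h])))"
  by (cases "m \<in> M") (auto simp: ta_eq co_zero)

text \<open>In terms of structure constants, this is the statement that A(a,b;F) is a
  representation.\<close>

lemma co_bracket:
  "(\<Sum>(c, k)\<leftarrow>br g h. sc c (sc (co k (m - deg [k])) (f (m - deg [k]))))
    = sc (co g (m - deg [g]) * co h (m - deg [g] - deg [h])
        - co h (m - deg [h]) * co g (m - deg [h] - deg [g])) (f (m - deg [g] - deg [h]))"
  by (cases g; cases h) (auto simp: algebra_simps)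

lemma vector_space_ts: "vector_space ts"
  by unfold_locales
    (auto simp: tsc_def fun_eq_iff V.scale_right_distrib V.scale_left_distrib)

lemma T_subspace: "module.subspace ts T"
proof -
  interpret TV: vector_space ts by (rule vector_space_ts)
  have fin: "finite {m. (f + g) m \<noteq> 0}"
    if "finite {m. f m \<noteq> 0}" "finite {m. g m \<noteq> 0}" for f g :: "int \<Rightarrow> 'v"
    using that by (rule_tac finite_subset[OF _ finite_UnI[OF that]]) auto
  show ?thesis
    unfolding TV.subspace_def
  proof (intro conjI ballI allI)
    show "0 \<in> T" by (simp add: tens_carrier_def V.zero_in)
    show "f + g \<in> T" if "f \<in> T" "g \<in> T" for f g
      using that fin[of f g] by (simp add: tens_carrier_def V.add_in)
    show "ts c f \<in> T" if "f \<in> T" for c f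
      using that by (auto simp: tens_carrier_def tsc_def V.scale_in elim!: rev_finite_subset)
  qed
qed

lemma ta_in: "f \<in> T \<Longrightarrow> ta g f \<in> T"
proof -
  assume f: "f \<in> T"
  let ?A = "{m. f m \<noteq> 0}"
  have "{m. ta g f m \<noteq> 0} \<subseteq> ?A \<union> (\<lambda>m. m + deg [g]) ` ?A"
  proof
    fix m assume "m \<in> {m. ta g f m \<noteq> 0}"
    then have "f m \<noteq> 0 \<or> f (m - deg [g]) \<noteq> 0"
      by (auto simp: ta_eq V.act_zero split: if_splits)
    then show "m \<in> ?A \<union> (\<lambda>m. m + deg [g]) ` ?A"
      by (auto simp del: deg.simps intro!: image_eqI[of _ _ "m - deg [g]"])
  qed
  then have "finite {m. ta g f m \<noteq> 0}"
    using f by (rule_tac finite_subset) (auto simp: tens_carrier_def)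
  moreover have "ta g f m \<in> C" for m
    using f by (auto simp: ta_eq tens_carrier_def V.act_in V.add_in V.scale_in V.zero_in)
  ultimately show "ta g f \<in> T" by (simp add: tens_carrier_def ta_eq)
qed

lemma ta_comm:
  assumes f: "f \<in> T"
  shows "ta g (ta h f) - ta h (ta g f) = (\<Sum>(c, k)\<leftarrow>br g h. ts c (ta k f))"
proof
  fix m
  have fC: "f i \<in> C" for i using f by (simp add: tens_carrier_def)
  show "(ta g (ta h f) - ta h (ta g f)) m = (\<Sum>(c, k)\<leftarrow>br g h. ts c (ta k f)) m"
  proof (cases "m \<in> M")
    case False
    have "(\<Sum>(c, k)\<leftarrow>l. sc c (0 :: 'v)) = 0" for l :: "(complex \<times> gen) list" by (induction l) auto
    with False show ?thesis by (simp add: sum_list_fun_apply tsc_def ta_eq)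
  next
    case True
    let ?i = "m - deg [g]" and ?j = "m - deg [h]" and ?k = "m - deg [g] - deg [h]"
    have k: "m - deg [h] - deg [g] = ?k" by simp
    \<comment> \<open>Exchanging \<open>g\<close> and \<open>h\<close> exchanges the two mixed
      terms, so they cancel in the commutator; the bracket on V and the bracket of the structure
      constants remain.\<close>
    have two: "ta g (ta h f) m = act g (act h (f m)) + sc (co h (m - deg [h])) (act g (f (m - deg [h])))
        + (sc (co g (m - deg [g])) (act h (f (m - deg [g])))
          + sc (co g (m - deg [g]) * co h (m - deg [g] - deg [h])) (f (m - deg [g] - deg [h])))" for g h
    proof -
      have "ta g (ta h f) m = act g (ta h f m) + sc (co g (m - deg [g])) (ta h f (m - deg [g]))"
        using True by (subst ta_eq) simp
      also have "act g (ta h f m) = act g (act h (f m)) + sc (co h (m - deg [h])) (act g (f (m - deg [h])))"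
        using True fC by (simp add: ta_eq V.act_add V.act_scale V.act_in V.scale_in)
      finally show ?thesis
        using co_ta[OF f, of g "m - deg [g]" h] by (simp add: V.scale_right_distrib)
    qed
    have "(\<Sum>(c, k)\<leftarrow>l. ts c (ta k f)) m = (\<Sum>(c, k)\<leftarrow>l. sc c (act k (f m)))
        + (\<Sum>(c, k)\<leftarrow>l. sc c (sc (co k (m - deg [k])) (f (m - deg [k]))))" for l
      using True by (induction l) (auto simp: tsc_def ta_eq V.scale_right_distrib)
    from this[of "br g h"] show ?thesis
      using V.act_comm[of g h "f m"] fC two[of g h] two[of h g] unfolding co_bracket k
      by (simp add: V.scale_left_diff_distrib del: deg.simps)
  qed
qed

lemma is_rep_T: "is_rep UNIV ts T ta"
proof -
  have "ta g (x + y) = ta g x + ta g y" if "x \<in> T" "y \<in> T" for g x y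
    using that by (auto simp: fun_eq_iff ta_eq V.act_add V.scale_right_distrib tens_carrier_def)
  moreover have "ta g (ts c x) = ts c (ta g x)" if "x \<in> T" for g c x
    using that by (auto simp: fun_eq_iff ta_eq tsc_def V.act_scale V.scale_right_distrib
        tens_carrier_def mult.commute)
  ultimately show ?thesis
    using vector_space_ts T_subspace ta_in ta_comm unfolding is_rep_def by blast
qed

sublocale T: lie_rep UNIV ts T ta
  by unfold_locales (simp_all add: is_rep_T)

text \<open>The pure tensor v (x) x^m. The value 0 for m outside \<open>M\<close> is the class of
  x^m in the quotient, and it keeps the Leibniz rule \<open>ta_ten\<close> free of conditions on
  m.\<close>

definition ten :: "'v \<Rightarrow> int \<Rightarrow> int \<Rightarrow> 'v" where
  "ten v m = (\<lambda>i. if i = m \<and> m \<in> M then v else 0)"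

lemma ten_in: "v \<in> C \<Longrightarrow> ten v m \<in> T"
  by (auto simp: ten_def tens_carrier_def V.zero_in)

lemma ten_zero: "ten 0 m = 0"
  and ten_add: "ten (x + y) m = ten x m + ten y m"
  and ten_scale: "ten (sc c x) m = ts c (ten x m)"
  by (auto simp: ten_def fun_eq_iff tsc_def)

lemma ten_notin: "m \<notin> M \<Longrightarrow> ten v m = 0"
  by (auto simp: ten_def fun_eq_iff)

lemma ta_ten: "ta g (ten v m) = ten (act g v) m + ts (co g m) (ten v (m + deg [g]))"
  using co_zero[of m g] by (auto simp: fun_eq_iff ta_eq ten_def tsc_def V.act_zero simp del: deg.simps)

lemma ten_expand: "f \<in> T \<Longrightarrow> f = (\<Sum>m\<in>{m. f m \<noteq> 0}. ten (f m) m)"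
proof
  fix i assume f: "f \<in> T"
  have "(\<Sum>m\<in>{m. f m \<noteq> 0}. ten (f m) m) i = (\<Sum>m\<in>{m. f m \<noteq> 0}. if m = i then f m else 0)"
    unfolding sum_fun_apply using f by (intro sum.cong) (auto simp: ten_def tens_carrier_def)
  also have "\<dots> = f i" using f by (simp add: sum.delta tens_carrier_def)
  finally show "f i = (\<Sum>m\<in>{m. f m \<noteq> 0}. ten (f m) m) i" ..
qed

end

lemma (in rep_space) subspace_scale_cancel:
  assumes "subspace S" "sc k x \<in> S" "k \<noteq> 0"
  shows "x \<in> S"
proof -
  have "sc (inverse k) (sc k x) \<in> S" by (rule subspace_scale[OF assms(1,2)])
  also have "sc (inverse k) (sc k x) = sc (inverse k * k) x" by (rule scale_scale)
  finally show ?thesis using assms(3) by simp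
qed

section \<open>Pure tensors inside a nonzero submodule\<close>

context tensor_rep
begin

text \<open>The sum of p(m) t_m (x) x^(m+c): the shape that t = sum of t_m (x) x^m keeps under
  operators that kill every t_m.\<close>

definition shifted :: "(int \<Rightarrow> 'v) \<Rightarrow> (int \<Rightarrow> complex) \<Rightarrow> int \<Rightarrow> int \<Rightarrow> 'v" where
  "shifted t p c = (\<Sum>m\<in>{m. t m \<noteq> 0}. ts (p m) (ten (t m) (m + c)))"

lemma shifted_add: "shifted t (\<lambda>m. p m + q m) c = shifted t p c + shifted t q c"
  by (simp add: shifted_def T.scale_left_distrib sum.distrib)

lemma shifted_scale: "shifted t (\<lambda>m. k * p m) c = ts k (shifted t p c)"
  unfolding shifted_def T.scale_sum_right T.scale_scale ..

lemma ta_shifted: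
  assumes t: "t \<in> T" and g: "\<And>m. act g (t m) = 0"
  shows "ta g (shifted t p c) = shifted t (\<lambda>m. p m * co g (m + c)) (c + deg [g])"
proof -
  have tC: "t m \<in> C" for m using t by (simp add: tens_carrier_def)
  show ?thesis
    unfolding shifted_def
    by (simp add: T.act_sum T.act_scale T.scale_in ten_in tC ta_ten g ten_zero add.assoc
        del: deg.simps)
qed

lemma shifted_polynomial:
  fixes q :: "complex poly"
  assumes S: "T.subspace S"
    and mem: "\<And>j. j \<le> degree q \<Longrightarrow> shifted t (\<lambda>m. p m * (a + of_int m) ^ j) c \<in> S"
  shows "shifted t (\<lambda>m. p m * poly q (a + of_int m)) c \<in> S"
proof -
  have "(\<Sum>j\<in>J. ts (coeff q j) (shifted t (\<lambda>m. p m * (a + of_int m) ^ j) c))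
      = shifted t (\<lambda>m. p m * (\<Sum>j\<in>J. coeff q j * (a + of_int m) ^ j)) c" if "finite J" for J
    using that
  proof (induction J)
    case empty
    show ?case by (simp add: shifted_def)
  next
    case (insert j J)
    have "shifted t (\<lambda>m. p m * (\<Sum>j\<in>insert j J. coeff q j * (a + of_int m) ^ j)) c
      = shifted t (\<lambda>m. coeff q j * (p m * (a + of_int m) ^ j)
          + p m * (\<Sum>j\<in>J. coeff q j * (a + of_int m) ^ j)) c"
      using insert by (simp add: algebra_simps)
    then show ?case using insert by (simp only: shifted_add shifted_scale) simp
  qed
  from this[of "{..degree q}"]
  have "shifted t (\<lambda>m. p m * poly q (a + of_int m)) c
      = (\<Sum>j\<in>{..degree q}. ts (coeff q j) (shifted t (\<lambda>m. p m * (a + of_int m) ^ j) c))"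
    by (simp add: poly_altdef)
  then show ?thesis using mem S by (auto intro!: T.subspace_sum T.subspace_scale)
qed

text \<open>Acting by d_c for large c kills the V-components and multiplies the coefficient of each
  summand by an affine function of its index. Hence all powers of a + m can be inserted, and a Lagrange
  polynomial isolates a single summand.\<close>
lemma isolate_summand:
  assumes S: "submodule UNIV ts T ta S" and t: "t \<in> T"
    and nil: "\<And>n m. n \<ge> N0 \<Longrightarrow> act (D n) (t m) = 0"
    and start: "\<And>c. c \<ge> N1 \<Longrightarrow> shifted t (p c) c \<in> S"
    and step: "\<And>c c'. \<exists>\<kappa>. \<forall>m. p c m * (a + of_int (m + c) + of_int c' * b)
      = p (c + c') m * (a + of_int m + \<kappa>)"
    and m0: "t m0 \<noteq> 0" "\<And>c. c \<ge> N2 \<Longrightarrow> p c m0 \<noteq> 0"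
  shows "\<exists>N. \<forall>m\<ge>N. ten (t m0) m \<in> S"
proof -
  have Ss: "T.subspace S" using S by (simp add: submodule_def)
  \<comment> \<open>Applying d_(c-N) at the fixed level \<open>N\<close> produces power j + 1 at
    level c plus \<kappa> times power j. The latter is already in S and is subtracted.\<close>
  have powers: "\<exists>N. \<forall>c\<ge>N. shifted t (\<lambda>m. p c m * (a + of_int m) ^ j) c \<in> S" for j
  proof (induction j)
    case 0
    show ?case using start by auto
  next
    case (Suc j)
    then obtain N where N: "\<And>c. c \<ge> N \<Longrightarrow> shifted t (\<lambda>m. p c m * (a + of_int m) ^ j) c \<in> S"
      by blast
    have "shifted t (\<lambda>m. p c m * (a + of_int m) ^ Suc j) c \<in> S" if c: "c \<ge> N + \<bar>N0\<bar>" for c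
    proof -
      let ?e = "c - N"
      have e: "?e \<ge> N0" "c \<ge> N" using c by linarith+
      obtain \<kappa> where \<kappa>: "\<And>m. p N m * (a + of_int (m + N) + of_int ?e * b)
          = p c m * (a + of_int m + \<kappa>)"
        using step[of N ?e] by auto
      have "ta (D ?e) (shifted t (\<lambda>m. p N m * (a + of_int m) ^ j) N) \<in> S"
        using N[of N] S by (simp add: submodule_def)
      also have "ta (D ?e) (shifted t (\<lambda>m. p N m * (a + of_int m) ^ j) N)
          = shifted t (\<lambda>m. p N m * (a + of_int m) ^ j * (a + of_int (m + N) + of_int ?e * b)) c"
        using ta_shifted[OF t nil[OF e(1)]] by simp
      also have "(\<lambda>m. p N m * (a + of_int m) ^ j * (a + of_int (m + N) + of_int ?e * b))
          = (\<lambda>m. p c m * (a + of_int m) ^ Suc j + \<kappa> * (p c m * (a + of_int m) ^ j))"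
      proof
        fix m
        have "p N m * (a + of_int m) ^ j * (a + of_int (m + N) + of_int ?e * b)
            = (p N m * (a + of_int (m + N) + of_int ?e * b)) * (a + of_int m) ^ j" by simp
        also have "\<dots> = p c m * (a + of_int m) ^ Suc j + \<kappa> * (p c m * (a + of_int m) ^ j)"
          unfolding \<kappa> by (simp add: algebra_simps)
        finally show "p N m * (a + of_int m) ^ j * (a + of_int (m + N) + of_int ?e * b)
            = p c m * (a + of_int m) ^ Suc j + \<kappa> * (p c m * (a + of_int m) ^ j)" .
      qed
      finally have "shifted t (\<lambda>m. p c m * (a + of_int m) ^ Suc j) c
          + ts \<kappa> (shifted t (\<lambda>m. p c m * (a + of_int m) ^ j) c) \<in> S"
        unfolding shifted_add shifted_scale .
      from T.subspace_diff[OF Ss this T.subspace_scale[OF Ss N[OF e(2)], of \<kappa>]]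
      show ?thesis by simp
    qed
    then show ?case by blast
  qed
  have fin: "finite {m. t m \<noteq> 0}" using t by (simp add: tens_carrier_def)
  define q where "q = (\<Prod>m\<in>{m. t m \<noteq> 0} - {m0}. [:- (a + of_int m), 1:])"
  have q0: "poly q (a + of_int m) = 0" if "t m \<noteq> 0" "m \<noteq> m0" for m
    unfolding q_def poly_prod using fin that by (auto simp: prod_zero_iff)
  have q1: "poly q (a + of_int m0) \<noteq> 0"
    unfolding q_def poly_prod using fin by (auto simp: prod_zero_iff)
  from powers obtain n where n:
    "\<And>j c. c \<ge> n j \<Longrightarrow> shifted t (\<lambda>m. p c m * (a + of_int m) ^ j) c \<in> S" by metis
  define N where "N = Max (n ` {..degree q})"
  \<comment> \<open>The shift m - m0 makes the surviving summand land on x^m, and \<open>N2\<close>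
    keeps its factor \<open>p ?c m0\<close> nonzero.\<close>
  have "ten (t m0) m \<in> S" if m: "m \<ge> m0 + max N N2" for m
  proof -
    let ?c = "m - m0"
    have "n j \<le> ?c" if "j \<le> degree q" for j
      using that m Max_ge[of "n ` {..degree q}" "n j"] unfolding N_def[symmetric] by auto
    then have "shifted t (\<lambda>m. p ?c m * poly q (a + of_int m)) ?c \<in> S"
      by (intro shifted_polynomial[OF Ss] n)
    also have "shifted t (\<lambda>m. p ?c m * poly q (a + of_int m)) ?c
        = (\<Sum>i\<in>{m. t m \<noteq> 0}. if i = m0 then ts (p ?c m0 * poly q (a + of_int m0)) (ten (t m0) m) else 0)"
      unfolding shifted_def using q0 by (intro sum.cong) auto
    also have "\<dots> = ts (p ?c m0 * poly q (a + of_int m0)) (ten (t m0) m)"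
      using m0 fin by simp
    finally show ?thesis
      by (rule T.subspace_scale_cancel[OF Ss]) (use q1 m0(2)[of ?c] m in simp)
  qed
  then show ?thesis by blast
qed

text \<open>\<open>isolate_summand\<close> is used with p = 1 whenever constant coefficients can be
  produced, and with p = a + m + cb when F = 0 and b is 0 or 1.\<close>

lemma contains_pure_tensors:
  assumes nilp: "\<And>v. v \<in> C \<Longrightarrow> \<exists>N. \<forall>n\<ge>N. act (D n) v = 0 \<and> act (J n) v = 0"
    and S: "submodule UNIV ts T ta S" "S \<noteq> {0}"
  shows "\<exists>v\<in>C. v \<noteq> 0 \<and> (\<exists>N. \<forall>m\<ge>N. ten v m \<in> S)"
proof -
  have Ss: "T.subspace S" using S by (simp add: submodule_def)
  obtain t where t: "t \<in> S" "t \<in> T" "t \<noteq> 0"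
    using S T.subspace_0[OF Ss] by (auto simp: submodule_def)
  obtain m0 where m0: "t m0 \<noteq> 0" using t(3) by (auto simp: fun_eq_iff)
  have m0M: "m0 \<in> M" "t m0 \<in> C" using t(2) m0 by (auto simp: tens_carrier_def)
  have fin: "finite {m. t m \<noteq> 0}" using t by (simp add: tens_carrier_def)
  have tC: "t m \<in> C" for m using t by (simp add: tens_carrier_def)
  obtain n where n: "\<And>m k. k \<ge> n m \<Longrightarrow> act (D k) (t m) = 0 \<and> act (J k) (t m) = 0"
    using nilp[OF tC] by metis
  \<comment> \<open>Inserting 0 makes the set nonempty and gives \<open>N \<ge> 0\<close>.\<close>
  define N where "N = Max (insert 0 (n ` {m. t m \<noteq> 0}))"
  have nil: "act (D k) (t m) = 0" "act (J k) (t m) = 0" if "k \<ge> N" for k m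
  proof -
    have "n m \<le> k" if "t m \<noteq> 0"
      using that \<open>k \<ge> N\<close> fin Max_ge[of "insert 0 (n ` {m. t m \<noteq> 0})" "n m"]
      unfolding N_def[symmetric] by auto
    then show "act (D k) (t m) = 0" "act (J k) (t m) = 0"
      using n[of m k] by (cases "t m = 0"; auto simp: V.act_zero)+
  qed
  have t_shifted: "t = shifted t (\<lambda>_. 1) 0"
    unfolding shifted_def using ten_expand[OF t(2)] by simp
  have act_S: "ta g x \<in> S" if "x \<in> S" for g x using S that by (simp add: submodule_def)
  have Dt: "shifted t (\<lambda>m. a + of_int m + of_int c * b) c \<in> S" if "c \<ge> N" for c
    using act_S[OF t(1), of "D c"] ta_shifted[OF t(2) nil(1)[OF that], of "\<lambda>_. 1" 0]
    unfolding t_shifted[symmetric] by simp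
  have "\<exists>N. \<forall>m\<ge>N. ten (t m0) m \<in> S"
  proof (cases "F = 0 \<and> (b = 0 \<or> b = 1)")
    case False
    \<comment> \<open>The bound leaves room for s = N, N + 1, N + 2 with c - s still at least
      \<open>N\<close>.\<close>
    have start: "shifted t (\<lambda>_. 1) c \<in> S" if c: "c \<ge> 2 * N + 2" for c
    proof (cases "F = 0")
      case False
      have "N \<ge> 0" unfolding N_def using fin by (intro Max_ge) auto
      then have "c \<ge> N" using c by simp
      have "ta (J c) t = ts F (shifted t (\<lambda>_. 1) c)"
        using ta_shifted[OF t(2) nil(2)[OF \<open>c \<ge> N\<close>], of "\<lambda>_. 1" 0]
        unfolding t_shifted[symmetric] shifted_scale[symmetric] by simp
      then show ?thesis
        using act_S[OF t(1), of "J c"] T.subspace_scale_cancel[OF Ss] False by simp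
    next
      case True
      \<comment> \<open>The coefficient of d_(c-s) d_s is quadratic in s with leading coefficient
        b(1-b), so its second difference in s is 2b(1-b), independent of m and nonzero here.\<close>
      let ?p = "\<lambda>s m. (a + of_int m + of_int s * b) * (a + of_int (m + s) + of_int (c - s) * b)"
      have "shifted t (?p s) c \<in> S" if "s \<ge> N" "c - s \<ge> N" for s
        using act_S[OF Dt[OF that(1)], of "D (c - s)"] ta_shifted[OF t(2) nil(1)[OF that(2)]]
        by simp
      from this[of N] this[of "N + 1"] this[of "N + 2"]
      have "shifted t (?p N) c \<in> S" "shifted t (?p (N + 1)) c \<in> S" "shifted t (?p (N + 2)) c \<in> S"
        using c by simp_all
      then have "shifted t (?p (N + 2)) c + (shifted t (?p N) c + ts (- 2) (shifted t (?p (N + 1)) c)) \<in> S"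
        by (intro T.subspace_add[OF Ss] T.subspace_scale[OF Ss])
      also have "shifted t (?p (N + 2)) c + (shifted t (?p N) c + ts (- 2) (shifted t (?p (N + 1)) c))
          = shifted t (\<lambda>m. ?p (N + 2) m + (?p N m + (- 2) * ?p (N + 1) m)) c"
        unfolding shifted_add shifted_scale ..
      also have "(\<lambda>m. ?p (N + 2) m + (?p N m + (- 2) * ?p (N + 1) m)) = (\<lambda>m. (2 * b * (1 - b)) * 1)"
        by (rule ext) (simp add: algebra_simps)
      finally have "ts (2 * b * (1 - b)) (shifted t (\<lambda>_. 1) c) \<in> S" unfolding shifted_scale .
      then show ?thesis
        by (rule T.subspace_scale_cancel[OF Ss]) (use False True in simp)
    qed
    show ?thesis
    proof (rule isolate_summand[OF S(1) t(2) nil(1), of N "2 * N + 2" _ _ 0])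
      show "shifted t (\<lambda>_. 1) c \<in> S" if "c \<ge> 2 * N + 2" for c by (rule start[OF that])
      show "\<exists>\<kappa>. \<forall>m. 1 * (a + of_int (m + c) + of_int c' * b) = 1 * (a + of_int m + \<kappa>)" for c c'
        by (rule exI[of _ "of_int c + of_int c' * b"]) simp
    qed (use m0 in auto)
  next
    case True
    \<comment> \<open>For b = 0 a zero would exclude \<open>m0\<close> from \<open>M\<close>; for b
      = 1 at most one c has to be avoided.\<close>
    have "\<exists>N2. \<forall>c\<ge>N2. a + of_int m0 + of_int c * b \<noteq> 0"
    proof (cases "b = 0")
      case True
      then show ?thesis using notin_M[of m0] m0M \<open>F = 0 \<and> _\<close> by auto
    next
      case False
      then have b: "b = 1" using True by simp
      show ?thesis
      proof (cases "\<exists>k. a + of_int m0 + of_int k = 0")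
        case True
        then obtain k where "a + of_int m0 + of_int k = 0" by blast
        then have "a + of_int m0 = - of_int k" by (simp add: eq_neg_iff_add_eq_0)
        then show ?thesis using b by (intro exI[of _ "k + 1"]) auto
      qed (use b in auto)
    qed
    then obtain N2 where N2: "\<And>c. c \<ge> N2 \<Longrightarrow> a + of_int m0 + of_int c * b \<noteq> 0" by blast
    show ?thesis
    proof (rule isolate_summand[OF S(1) t(2) nil(1), of N])
      show "shifted t (\<lambda>m. a + of_int m + of_int c * b) c \<in> S" if "c \<ge> N" for c
        by (rule Dt[OF that])
      show "\<exists>\<kappa>. \<forall>m. (a + of_int m + of_int c * b) * (a + of_int (m + c) + of_int c' * b)
          = (a + of_int m + of_int (c + c') * b) * (a + of_int m + \<kappa>)" for c c'
        by (rule exI[of _ "of_int c"]) (use True in \<open>auto simp: algebra_simps\<close>)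
      show "a + of_int m0 + of_int c * b \<noteq> 0" if "c \<ge> N2" for c by (rule N2[OF that])
    qed (use m0 in auto)
  qed
  then show ?thesis using m0 m0M by blast
qed

text \<open>By the Leibniz rule, (g x) (x) x^m needs x only at the indices m and m + deg g, and both
  "all m" and "all large m" survive such a shift. The second set leads from an unspecified vector to
  the highest weight vector, the first from that vector to all of \<open>T\<close>.\<close>

lemma stable_vectors_submodule:
  assumes S: "submodule UNIV ts T ta S"
  shows "submodule UNIV sc C act {v\<in>C. \<forall>m. ten v m \<in> S}"
    and "submodule UNIV sc C act {v\<in>C. \<exists>N. \<forall>m\<ge>N. ten v m \<in> S}"
proof -
  have Ss: "T.subspace S" using S by (simp add: submodule_def)
  have 0: "ten 0 m \<in> S" for m using T.subspace_0[OF Ss] by (simp add: ten_zero)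
  have add: "ten (x + y) m \<in> S" if "ten x m \<in> S" "ten y m \<in> S" for x y m
    using that T.subspace_add[OF Ss] by (simp add: ten_add)
  have sca: "ten (sc c x) m \<in> S" if "ten x m \<in> S" for c x m
    using that T.subspace_scale[OF Ss] by (simp add: ten_scale)
  have act: "ten (act g x) m \<in> S" if "ten x m \<in> S" "ten x (m + deg [g]) \<in> S" for g x m
  proof -
    have "ta g (ten x m) \<in> S" using that(1) S by (simp add: submodule_def)
    then show ?thesis
      using T.subspace_diff[OF Ss _ T.subspace_scale[OF Ss that(2), of "co g m"]]
      unfolding ta_ten by (metis add_diff_cancel_right')
  qed
  show "submodule UNIV sc C act {v\<in>C. \<forall>m. ten v m \<in> S}"
    by (rule V.submoduleI)
      (auto simp: V.zero_in V.add_in V.scale_in V.act_in 0 add sca act simp del: deg.simps)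
  show "submodule UNIV sc C act {v\<in>C. \<exists>N. \<forall>m\<ge>N. ten v m \<in> S}"
  proof (rule V.submoduleI)
    fix x assume "x \<in> {v\<in>C. \<exists>N. \<forall>m\<ge>N. ten v m \<in> S}"
    then obtain N where x: "x \<in> C" "\<And>m. m \<ge> N \<Longrightarrow> ten x m \<in> S" by blast
    show "sc c x \<in> {v\<in>C. \<exists>N. \<forall>m\<ge>N. ten v m \<in> S}" for c
      using x sca by (auto simp: V.scale_in intro!: exI[of _ N])
    show "act g x \<in> {v\<in>C. \<exists>N. \<forall>m\<ge>N. ten v m \<in> S}" for g
    proof -
      have "ten (act g x) m \<in> S" if m: "m \<ge> N + \<bar>deg [g]\<bar>" for m
      proof -
        have "m \<ge> N" "m + deg [g] \<ge> N" using m by linarith+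
        then show ?thesis by (intro act x)
      qed
      then show ?thesis using x by (auto simp: V.act_in)
    qed
    show "x + y \<in> {v\<in>C. \<exists>N. \<forall>m\<ge>N. ten v m \<in> S}"
      if "y \<in> {v\<in>C. \<exists>N. \<forall>m\<ge>N. ten v m \<in> S}" for y
    proof -
      from that obtain N' where y: "y \<in> C" "\<And>m. m \<ge> N' \<Longrightarrow> ten y m \<in> S" by blast
      have "ten (x + y) m \<in> S" if "m \<ge> max N N'" for m using x y that by (intro add) auto
      then show ?thesis using x y by (auto simp: V.add_in intro!: exI[of _ "max N N'"])
    qed
  qed (auto simp: V.zero_in 0)
qed

lemma submodule_eq_T:
  assumes S: "submodule UNIV ts T ta S" and V: "simple_rep UNIV sc C act"
    and w: "w \<in> C" "w \<noteq> 0" "\<And>m. ten w m \<in> S"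
  shows "S = T"
proof -
  have Ss: "T.subspace S" and ST: "S \<subseteq> T" using S by (auto simp: submodule_def)
  have "{v\<in>C. \<forall>m. ten v m \<in> S} = C"
    using stable_vectors_submodule(1)[OF S] V w unfolding simple_rep_def by blast
  then have all: "ten v m \<in> S" if "v \<in> C" for v m using that by blast
  have "f \<in> S" if "f \<in> T" for f
  proof -
    have "(\<Sum>m\<in>{m. f m \<noteq> 0}. ten (f m) m) \<in> S"
      using that by (intro T.subspace_sum[OF Ss] all) (simp add: tens_carrier_def)
    then show ?thesis using ten_expand[OF that] by simp
  qed
  then show ?thesis using ST by blast
qed

text \<open>Simplicity of V already puts w (x) x^m in S for all large m; \<open>descent\<close> then
  lowers the index one step at a time, and missing indices cost nothing because the tensor is 0
  there.\<close>

lemma simple_T_if_descent: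
  assumes V: "is_V_L sc C act I0 d0 z1 z2 z3" and w: "w \<in> C" "w \<noteq> 0"
    and descent: "\<And>S n. submodule UNIV ts T ta S \<Longrightarrow> (\<And>m. m > n \<Longrightarrow> ten w m \<in> S) \<Longrightarrow> n \<in> M
      \<Longrightarrow> ten w n \<in> S"
  shows "simple_rep UNIV ts T ta"
  unfolding simple_rep_def
proof (intro conjI allI impI)
  have simple: "simple_rep UNIV sc C act" using V by (simp add: is_V_L_def)
  have "\<exists>m. m \<in> M"
  proof (rule ccontr)
    assume "\<nexists>m. m \<in> M"
    then show False using notin_M[of 0] notin_M[of 1] by auto
  qed
  then obtain m where m: "m \<in> M" by blast
  have "ten w m m \<noteq> 0" using w m by (simp add: ten_def)
  then show "T \<noteq> {0}" using ten_in[OF w(1), of m] by auto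
  fix S assume S: "submodule UNIV ts T ta S"
  show "S = {0} \<or> S = T"
  proof (cases "S = {0}")
    case False
    have nilp: "\<exists>N. \<forall>n\<ge>N. act (D n) v = 0 \<and> act (J n) v = 0" if "v \<in> C" for v
      by (rule locally_nilpotent[OF V that])
    obtain v N where v: "v \<in> C" "v \<noteq> 0" "\<forall>m\<ge>N. ten v m \<in> S"
      using contains_pure_tensors[OF nilp S False] by blast
    then have "{v\<in>C. \<exists>N. \<forall>m\<ge>N. ten v m \<in> S} = C"
      using stable_vectors_submodule(2)[OF S] simple unfolding simple_rep_def by blast
    then obtain N where N: "\<And>m. m \<ge> N \<Longrightarrow> ten w m \<in> S" using w by blast
    have down: "\<forall>m\<ge>N - int k. ten w m \<in> S" for k
    proof (induction k)
      case 0
      show ?case using N by simp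
    next
      case (Suc k)
      have "ten w (N - int (Suc k)) \<in> S"
      proof (cases "N - int (Suc k) \<in> M")
        case True
        have "ten w m \<in> S" if "m > N - int (Suc k)" for m using that Suc by simp
        then show ?thesis by (rule descent[OF S _ True])
      next
        case False
        then show ?thesis using S T.subspace_0 by (simp add: ten_notin submodule_def)
      qed
      show ?case
      proof (intro allI impI)
        fix m assume "m \<ge> N - int (Suc k)"
        then have "m = N - int (Suc k) \<or> m \<ge> N - int k" by auto
        then show "ten w m \<in> S" using Suc \<open>ten w (N - int (Suc k)) \<in> S\<close> by blast
      qed
    qed
    have "ten w m \<in> S" for m
      using down[of "nat (N - m)"] by (auto simp: not_le elim!: allE[of _ m])
    then show ?thesis using submodule_eq_T[OF S simple w] by blast
  qed simp
qed

text \<open>If v (x) x^m is in S, then (g v) (x) x^m is congruent to \<open>- co g m\<close> times v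
  (x) x^(m + deg g). For m = n - deg (g u) this factor is the one in the recursion of
  \<open>rho\<close>. The first claim provides the membership, because a negative letter leaves m +
  deg u > n for the shorter word.\<close>

lemma rho_congruence:
  assumes S: "submodule UNIV ts T ta S" and w: "w \<in> C" and n: "\<And>m. m > n \<Longrightarrow> ten w m \<in> S"
    and u: "neg_word UNIV u"
  shows "m + deg u > n \<Longrightarrow> ten (wact act u w) m \<in> S"
    and "m + deg u = n \<Longrightarrow> ten (wact act u w) m - ts (rho a b F n u) (ten w n) \<in> S"
proof -
  have Ss: "T.subspace S" using S by (simp add: submodule_def)
  have rec: "ten (act g v) m = ta g (ten v m) - ts (co g m) (ten v (m + deg [g]))" for g v m
    by (simp add: ta_ten)
  have act_S: "ta g x \<in> S" if "x \<in> S" for g x using S that by (simp add: submodule_def)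
  have high: "ten (wact act u w) m \<in> S" if "neg_word UNIV u" "m + deg u > n" for u m
    using that
  proof (induction u arbitrary: m)
    case Nil
    then show ?case using n by simp
  next
    case (Cons g u)
    have d: "deg (g # u) = deg [g] + deg u" by (cases g) auto
    have "deg [g] < 0" using Cons.prems deg_neg_word[of UNIV "[g]"] by simp
    then have "ten (wact act u w) m \<in> S" "ten (wact act u w) (m + deg [g]) \<in> S"
      using Cons d by (intro Cons.IH; simp)+
    then show ?case unfolding wact.simps rec
      by (intro T.subspace_diff[OF Ss] T.subspace_scale[OF Ss] act_S)
  qed
  then show "m + deg u > n \<Longrightarrow> ten (wact act u w) m \<in> S" using u by blast
  show "m + deg u = n \<Longrightarrow> ten (wact act u w) m - ts (rho a b F n u) (ten w n) \<in> S"
    using u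
  proof (induction u arbitrary: m)
    case Nil
    then show ?case using T.subspace_0[OF Ss] by (simp add: zero_fun_def)
  next
    case (Cons g u)
    have d: "deg (g # u) = deg [g] + deg u" by (cases g) auto
    have g: "deg [g] < 0" using Cons.prems deg_neg_word[of UNIV "[g]"] by simp
    let ?y = "ten (wact act u w) (m + deg [g])"
    have \<rho>: "rho a b F n (g # u) = - co g m * rho a b F n u"
      using Cons.prems by (cases g) (auto simp: algebra_simps)
    have "?y - ts (rho a b F n u) (ten w n) \<in> S" using Cons d by (intro Cons.IH) simp_all
    then have "ta g (ten (wact act u w) m) + ts (- co g m) (?y - ts (rho a b F n u) (ten w n)) \<in> S"
      using Cons.prems d g by (intro T.subspace_add[OF Ss] T.subspace_scale[OF Ss] act_S high) auto
    also have "ta g (ten (wact act u w) m) + ts (- co g m) (?y - ts (rho a b F n u) (ten w n))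
        = ten (act g (wact act u w)) m - ts (rho a b F n (g # u)) (ten w n)"
      unfolding rec \<rho> by (simp add: T.scale_right_diff_distrib del: deg.simps)
    finally show ?case by simp
  qed
qed

text \<open>With d the common degree of the words of Q, every u w (x) x^(n-d) has total degree n.
  Summing the congruences shows that 0 = Q w (x) x^(n-d) is congruent to rho_n(Q) w (x) x^n.\<close>

lemma descent_by_relation:
  assumes S: "submodule UNIV ts T ta S" and w: "w \<in> C" and n: "\<And>m. m > n \<Longrightarrow> ten w m \<in> S"
    and Q: "homog Q" "fa_act sc act Q w = 0" "rhoQ a b F n Q \<noteq> 0"
  shows "ten w n \<in> S"
proof -
  have Ss: "T.subspace S" using S by (simp add: submodule_def)
  obtain d where "\<forall>(c, u)\<in>set Q. deg u = d"
    using Q(1) unfolding homog_def by (elim conjE exE)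
  then have d: "deg u = d" if "(c, u) \<in> set Q" for c u using that by auto
  have neg: "neg_word UNIV u" if "(c, u) \<in> set Q" for c u
    using homog_neg_word[OF Q(1)] that by auto
  have "ten (fa_act sc act P w) (n - d) - ts (rhoQ a b F n P) (ten w n) \<in> S" if "set P \<subseteq> set Q" for P
    using that
  proof (induction P)
    case Nil
    then show ?case using T.subspace_0[OF Ss] by (simp add: fa_act_def rhoQ_def ten_zero zero_fun_def)
  next
    case (Cons p P)
    obtain c u where p: "p = (c, u)" by force
    have "ten (wact act u w) (n - d) - ts (rho a b F n u) (ten w n) \<in> S"
      using Cons.prems p d neg by (intro rho_congruence(2)[OF S w n]) auto
    then have "ts c (ten (wact act u w) (n - d) - ts (rho a b F n u) (ten w n))
        + (ten (fa_act sc act P w) (n - d) - ts (rhoQ a b F n P) (ten w n)) \<in> S"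
      by (rule T.subspace_add[OF Ss T.subspace_scale[OF Ss] Cons.IH]) (use Cons.prems in auto)
    moreover have "ten (fa_act sc act (p # P) w) (n - d) - ts (rhoQ a b F n (p # P)) (ten w n)
        = ts c (ten (wact act u w) (n - d) - ts (rho a b F n u) (ten w n))
          + (ten (fa_act sc act P w) (n - d) - ts (rhoQ a b F n P) (ten w n))"
      unfolding p by (simp add: V.fa_act_Cons ten_add ten_scale rhoQ_def
          T.scale_right_diff_distrib T.scale_left_distrib algebra_simps)
    ultimately show ?case by (simp only:)
  qed
  from this[of Q] have "- ts (rhoQ a b F n Q) (ten w n) \<in> S"
    unfolding Q(2) ten_zero by simp
  then have "ts (rhoQ a b F n Q) (ten w n) \<in> S" using T.subspace_neg[OF Ss] by fastforce
  then show ?thesis by (rule T.subspace_scale_cancel[OF Ss]) (rule Q(3))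
qed

end

section \<open>A proper submodule when rho_n kills both generators\<close>

context rep_space
begin

lemma neg_span_fa_act:
  assumes "w \<in> C" "v \<in> neg_span G sc act {w}"
  shows "\<exists>Q. (\<forall>(c, u)\<in>set Q. neg_word G u) \<and> fa_act sc act Q w = v"
  using assms(2) unfolding neg_span_def
proof (induction rule: span_induct_alt)
  case base
  show ?case by (rule exI[of _ "[]"]) (simp add: fa_act_Nil)
next
  case (step c x y)
  then obtain u Q where "neg_word G u" "x = wact act u w" "\<forall>(c, u)\<in>set Q. neg_word G u"
    "fa_act sc act Q w = y" by blast
  then show ?case by (intro exI[of _ "(c, u) # Q"]) (auto simp: fa_act_Cons)
qed

end

context tensor_rep
begin

text \<open>This recursion is exactly the condition that the functional assembled from
  \<open>theta\<close> annihilates g (v (x) x^m) for negative g.\<close>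

lemma theta_Cons:
  assumes "neg_gen g"
  shows "theta a b F n m (g # u) = - co g m * theta a b F n (m + deg [g]) u"
  using assms by (cases g) (auto simp: theta_def algebra_simps)

text \<open>The functional must vanish where the tensor does. A leading letter contributes the
  factor \<open>co g m\<close>, zero for a missing m, and the empty word would need m = n.\<close>

lemma theta_notin_M:
  assumes "m \<notin> M" "n \<in> M" "neg_word UNIV u"
  shows "theta a b F n m u = 0"
proof (cases u)
  case Nil
  then show ?thesis using assms by (auto simp: theta_def)
next
  case (Cons g u')
  then show ?thesis using assms by (simp add: theta_Cons co_zero del: deg.simps)
qed

text \<open>The functionals v -> theta(u), v = u w, on V assemble to a functional on the tensor product that
  annihilates its image under L^- and the vectors w (x) x^m with m > n, but not w (x) x^n.\<close>
lemma not_simple_T: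
  assumes w: "hwv UNIV sc C act \<chi> w" and C: "C = neg_span UNIV sc act {w}" and n: "n \<in> M"
    and welldef: "\<And>m Q. \<forall>(c, u)\<in>set Q. neg_word UNIV u \<Longrightarrow> fa_act sc act Q w = 0 \<Longrightarrow>
      (\<Sum>(c, u)\<leftarrow>Q. c * theta a b F n m u) = 0"
  shows "\<not> simple_rep UNIV ts T ta"
proof -
  have wC: "w \<in> C" "w \<noteq> 0" using w by (auto simp: hwv_def)
  have fa: "\<exists>Q. (\<forall>(c, u)\<in>set Q. neg_word UNIV u) \<and> fa_act sc act Q w = v" if "v \<in> C" for v
    using V.neg_span_fa_act[OF wC(1)] that C by simp
  \<comment> \<open>The representative Q of v = Q w is chosen arbitrarily; \<open>welldef\<close>,
    applied to the difference of two representatives, removes the dependence on it.\<close>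
  define \<tau> where "\<tau> m v = (\<Sum>(c, u)\<leftarrow>(SOME Q. (\<forall>(c, u)\<in>set Q. neg_word UNIV u) \<and> fa_act sc act Q w = v).
    c * theta a b F n m u)" for m v
  have \<tau>: "\<tau> m (fa_act sc act Q w) = (\<Sum>(c, u)\<leftarrow>Q. c * theta a b F n m u)"
    if Q: "\<forall>(c, u)\<in>set Q. neg_word UNIV u" for m Q
  proof -
    define Q' where "Q' = (SOME Q'. (\<forall>(c, u)\<in>set Q'. neg_word UNIV u)
      \<and> fa_act sc act Q' w = fa_act sc act Q w)"
    have Q': "(\<forall>(c, u)\<in>set Q'. neg_word UNIV u) \<and> fa_act sc act Q' w = fa_act sc act Q w"
      unfolding Q'_def by (rule someI[of _ Q]) (use Q in simp)
    have "(\<Sum>(c, u)\<leftarrow>Q' @ map (\<lambda>(d, u). (- 1 * d, u)) Q. c * theta a b F n m u) = 0"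
    proof (rule welldef)
      show "\<forall>(c, u)\<in>set (Q' @ map (\<lambda>(d, u). (- 1 * d, u)) Q). neg_word UNIV u"
        using Q Q' by auto
      show "fa_act sc act (Q' @ map (\<lambda>(d, u). (- 1 * d, u)) Q) w = 0"
        unfolding V.fa_act_append V.fa_act_smult using Q' by simp
    qed
    moreover have "(\<Sum>(d, u)\<leftarrow>map (\<lambda>(d, u). (- 1 * d, u)) Q. d * theta a b F n m u)
        = - (\<Sum>(d, u)\<leftarrow>Q. d * theta a b F n m u)"
      by (induction Q) (auto simp: algebra_simps)
    ultimately show ?thesis unfolding \<tau>_def Q'_def[symmetric] by simp
  qed
  have \<tau>_add: "\<tau> m (x + y) = \<tau> m x + \<tau> m y" if "x \<in> C" "y \<in> C" for m x y
  proof -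
    obtain P Q where PQ: "\<forall>(c, u)\<in>set P. neg_word UNIV u" "fa_act sc act P w = x"
      "\<forall>(c, u)\<in>set Q. neg_word UNIV u" "fa_act sc act Q w = y"
      using fa \<open>x \<in> C\<close> \<open>y \<in> C\<close> by blast
    have "\<tau> m (fa_act sc act (P @ Q) w) = \<tau> m (fa_act sc act P w) + \<tau> m (fa_act sc act Q w)"
      using PQ by (subst (1 2 3) \<tau>) auto
    then show ?thesis using PQ by (simp add: V.fa_act_append)
  qed
  have \<tau>_scale: "\<tau> m (sc c x) = c * \<tau> m x" if "x \<in> C" for m c x
  proof -
    obtain P where P: "\<forall>(c, u)\<in>set P. neg_word UNIV u" "fa_act sc act P w = x"
      using fa \<open>x \<in> C\<close> by blast
    have "(\<Sum>(d, u)\<leftarrow>map (\<lambda>(d, u). (c * d, u)) P. d * theta a b F n m u)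
        = c * (\<Sum>(d, u)\<leftarrow>P. d * theta a b F n m u)"
      by (induction P) (auto simp: algebra_simps)
    then have "\<tau> m (fa_act sc act (map (\<lambda>(d, u). (c * d, u)) P) w) = c * \<tau> m (fa_act sc act P w)"
      using P by (subst (1 2) \<tau>) auto
    then show ?thesis using P by (simp add: V.fa_act_smult)
  qed
  have \<tau>_zero: "\<tau> m 0 = 0" for m using \<tau>[of "[]" m] by (simp add: V.fa_act_Nil)
  have \<tau>_notin: "\<tau> m v = 0" if "m \<notin> M" "v \<in> C" for m v
  proof -
    obtain P where P: "\<forall>(c, u)\<in>set P. neg_word UNIV u" "fa_act sc act P w = v"
      using fa \<open>v \<in> C\<close> by blast
    have "(\<Sum>(c, u)\<leftarrow>P. c * theta a b F n m u) = 0"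
      using P(1) theta_notin_M[OF \<open>m \<notin> M\<close> n] by (induction P) auto
    then show ?thesis using \<tau>[OF P(1)] P(2) by simp
  qed
  have \<tau>_act: "\<tau> m (act g v) + co g m * \<tau> (m + deg [g]) v = 0" if "neg_gen g" "v \<in> C" for m g v
  proof -
    obtain P where P: "\<forall>(c, u)\<in>set P. neg_word UNIV u" "fa_act sc act P w = v"
      using fa \<open>v \<in> C\<close> by blast
    let ?P = "map (\<lambda>(c, u). (c, [g] @ u)) P"
    have "act g v = fa_act sc act ?P w"
      using V.wact_fa_act[of P "[g]" w] P(2) wC by simp
    moreover have "\<forall>(c, u)\<in>set ?P. neg_word UNIV u" using P(1) \<open>neg_gen g\<close> by auto
    ultimately have "\<tau> m (act g v) = (\<Sum>(c, u)\<leftarrow>?P. c * theta a b F n m u)"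
      using \<tau>[of ?P m] by (simp only:)
    also have "\<dots> = - co g m * (\<Sum>(c, u)\<leftarrow>P. c * theta a b F n (m + deg [g]) u)"
      by (induction P) (auto simp: theta_Cons[OF \<open>neg_gen g\<close>] distrib_left simp del: deg.simps)
    also have "(\<Sum>(c, u)\<leftarrow>P. c * theta a b F n (m + deg [g]) u) = \<tau> (m + deg [g]) v"
      using \<tau>[OF P(1)] P(2) by simp
    finally show ?thesis by simp
  qed
  define \<psi> where "\<psi> f = (\<Sum>m\<in>{m. f m \<noteq> 0}. \<tau> m (f m))" for f
  have \<psi>_eq: "\<psi> f = (\<Sum>m\<in>A. \<tau> m (f m))" if "finite A" "{m. f m \<noteq> 0} \<subseteq> A" for f A
    unfolding \<psi>_def using that by (intro sum.mono_neutral_left) (auto simp: \<tau>_zero)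
  have \<psi>_add: "\<psi> (f + h) = \<psi> f + \<psi> h" if "f \<in> T" "h \<in> T" for f h
  proof -
    let ?A = "{m. f m \<noteq> 0} \<union> {m. h m \<noteq> 0}"
    have "finite ?A" using that by (simp add: tens_carrier_def)
    moreover have "{m. (f + h) m \<noteq> 0} \<subseteq> ?A" by auto
    ultimately show ?thesis
      using that \<psi>_eq[of ?A f] \<psi>_eq[of ?A h] \<psi>_eq[of ?A "f + h"]
      by (auto simp: \<tau>_add tens_carrier_def sum.distrib)
  qed
  have \<psi>_scale: "\<psi> (ts c f) = c * \<psi> f" if "f \<in> T" for c f
  proof -
    have "finite {m. f m \<noteq> 0}" using that by (simp add: tens_carrier_def)
    then have "\<psi> (ts c f) = (\<Sum>m\<in>{m. f m \<noteq> 0}. \<tau> m (ts c f m))"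
      by (intro \<psi>_eq) (auto simp: tsc_def)
    then show ?thesis
      using that by (simp add: \<psi>_def tsc_def \<tau>_scale tens_carrier_def sum_distrib_left)
  qed
  have \<psi>_zero: "\<psi> 0 = 0" by (simp add: \<psi>_def)
  have \<psi>_sum: "\<psi> (\<Sum>i\<in>I. f i) = (\<Sum>i\<in>I. \<psi> (f i))" if "\<And>i. i \<in> I \<Longrightarrow> f i \<in> T" for I and f :: "int \<Rightarrow> int \<Rightarrow> 'v"
    using that
  proof (induction I rule: infinite_finite_induct)
    case (insert i I)
    have "sum f I \<in> T" using insert.prems by (intro T.subspace_sum[OF T_subspace]) blast
    then have "\<psi> (f i + sum f I) = \<psi> (f i) + \<psi> (sum f I)"
      using insert.prems by (intro \<psi>_add) blast+
    moreover have "\<psi> (sum f I) = (\<Sum>i\<in>I. \<psi> (f i))" using insert by blast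
    ultimately show ?case unfolding sum.insert[OF insert(1,2)] by (simp only:)
  qed (auto simp: \<psi>_zero)
  have \<psi>_ten: "\<psi> (ten v m) = \<tau> m v" if "v \<in> C" for v m
  proof (cases "m \<in> M")
    case True
    have "\<psi> (ten v m) = (\<Sum>i\<in>{m}. \<tau> i (ten v m i))" by (rule \<psi>_eq) (auto simp: ten_def)
    then show ?thesis using True by (simp add: ten_def)
  next
    case False
    then show ?thesis using \<tau>_notin[OF False that] \<psi>_zero by (simp add: ten_notin)
  qed
  have \<psi>_neg: "\<psi> (ta g f) = 0" if "neg_gen g" "f \<in> T" for g f
  proof -
    have fC: "f m \<in> C" for m using that(2) by (simp add: tens_carrier_def)
    have ten0: "\<psi> (ta g (ten (f m) m)) = 0" for m
      unfolding ta_ten using \<tau>_act[OF that(1) fC]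
      by (simp add: \<psi>_add \<psi>_scale \<psi>_ten ten_in V.act_in fC T.scale_in del: deg.simps)
    have "ta g f = ta g (\<Sum>m\<in>{m. f m \<noteq> 0}. ten (f m) m)" using ten_expand[OF that(2)] by simp
    also have "\<dots> = (\<Sum>m\<in>{m. f m \<noteq> 0}. ta g (ten (f m) m))"
      by (rule T.act_sum) (auto simp: ten_in fC)
    finally have "\<psi> (ta g f) = \<psi> (\<Sum>m\<in>{m. f m \<noteq> 0}. ta g (ten (f m) m))" by (rule arg_cong)
    also have "\<dots> = (\<Sum>m\<in>{m. f m \<noteq> 0}. \<psi> (ta g (ten (f m) m)))"
      by (rule \<psi>_sum) (auto simp: ten_in fC ta_in)
    finally show ?thesis using ten0 by simp
  qed
  have \<tau>w: "\<tau> m w = (if m = n then 1 else 0)" for m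
  proof -
    have "\<tau> m (fa_act sc act [(1, [])] w) = (if m = n then 1 else 0)"
      by (subst \<tau>) (auto simp: theta_def)
    then show ?thesis by (simp add: V.fa_act_Cons V.fa_act_Nil)
  qed
  let ?P = "{ten w m | m. m > n}"
  define X where "X = neg_span UNIV ts ta ?P"
  have PT: "?P \<subseteq> T" using ten_in wC by blast
  have PX: "?P \<subseteq> X" unfolding X_def by (rule T.neg_span_superset)
  have Xs: "T.subspace X" by (simp add: X_def neg_span_def)
  \<comment> \<open>A generator that is not negative acts on \<open>w\<close> by a scalar and does
    not lower the index, so it keeps the span of the w (x) x^m with m > n; negative words then
    generate the whole submodule.\<close>
  have X: "submodule UNIV ts T ta X"
    unfolding X_def
  proof (rule T.neg_span_submodule[OF PT])
    fix g p assume g: "\<not> neg_gen g" and "p \<in> ?P"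
    then obtain m where m: "p = ten w m" "m > n" by blast
    have "deg [g] \<ge> 0" using g by (cases g) auto
    moreover have "ten w k \<in> X" if "k > n" for k using PX that by blast
    ultimately have "ten w m \<in> X" "ten w (m + deg [g]) \<in> X" using m(2) by simp_all
    moreover have "act g w = sc (\<chi> g) w" using w g by (simp add: hwv_def)
    ultimately have "ta g p \<in> X"
      unfolding m(1) ta_ten
      by (auto simp: ten_scale intro!: T.subspace_add[OF Xs] T.subspace_scale[OF Xs] simp del: deg.simps)
    then show "ta g p \<in> neg_span UNIV ts ta ?P" by (simp add: X_def)
  qed
  have \<psi>X: "\<psi> x = 0" if "x \<in> X" for x
  proof -
    have "x \<in> T \<and> \<psi> x = 0"
      using that unfolding X_def neg_span_def
    proof (induction rule: T.span_induct_alt)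
      case base
      show ?case using \<psi>_zero T.zero_in by (simp add: zero_fun_def)
    next
      case (step c x y)
      then obtain u m where u: "neg_word UNIV u" "m > n" "x = wact ta u (ten w m)" by blast
      have xT: "x \<in> T" using u T.wact_in[of u "ten w m"] ten_in wC by simp
      have "\<psi> x = 0"
      \<comment> \<open>The empty word leaves w (x) x^m with m different from n, and a nonempty word
        lies in the image of its first, negative letter; \<psi> is zero on both.\<close>
      proof (cases u)
        case Nil
        then show ?thesis using u wC by (simp add: \<psi>_ten \<tau>w)
      next
        case (Cons g u')
        have "wact ta u' (ten w m) \<in> T" using T.wact_in[of u' "ten w m"] ten_in wC by simp
        then show ?thesis using u Cons \<psi>_neg by simp
      qed
      then show ?case
        using step(2) xT \<psi>_add[OF T.scale_in[OF xT], of y c] \<psi>_scale[OF xT, of c]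
          T.add_in[OF T.scale_in[OF xT], of y c] by (simp only:) simp
    qed
    then show ?thesis by blast
  qed
  \<comment> \<open>Needed for X to be nonzero: at most one index is missing, so n + 1 or n + 2 is
    present.\<close>
  have "\<exists>m>n. m \<in> M"
  proof (rule ccontr)
    assume "\<not> (\<exists>m>n. m \<in> M)"
    then have "a + of_int (n + 1) = a + of_int (n + 2)"
      using notin_M[of "n + 1"] notin_M[of "n + 2"] by simp
    then show False by simp
  qed
  then obtain m where m: "m > n" "m \<in> M" by blast
  have "ten w m m \<noteq> 0" using m wC by (simp add: ten_def)
  then have "ten w m \<noteq> 0" by auto
  moreover have "ten w m \<in> X" using m PX by blast
  moreover have "ten w n \<in> T" "ten w n \<notin> X"
    using ten_in wC \<psi>X[of "ten w n"] by (auto simp: \<psi>_ten \<tau>w)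
  ultimately show ?thesis using X unfolding simple_rep_def by blast
qed

lemma simple_T_iff:
  assumes M: "is_Verma scm Cm actm I0 d0 z1 z2 z3 wm" "max_sub_gen scm Cm actm wm Q1 Q2"
    and Q: "homog Q1" "homog Q2" and V: "is_V_L sc C act I0 d0 z1 z2 z3"
  shows "simple_rep UNIV ts T ta \<longleftrightarrow> (\<forall>n\<in>M. (rhoQ a b F n Q1, rhoQ a b F n Q2) \<noteq> (0, 0))"
proof -
  obtain w where hw: "is_hw_L sc C act I0 d0 z1 z2 z3 w" using V by (auto simp: is_V_L_def)
  then have w: "hwv UNIV sc C act (hw_fun I0 d0 z1 z2 z3) w" "w \<in> C" "w \<noteq> 0"
    using is_hw_L_hwv[OF V.vector_space_axioms] by (auto simp: is_hw_L_def)
  have C: "C = neg_span UNIV sc act {w}"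
    using V V.simple_eq_neg_span[OF _ w(1)] unfolding is_V_L_def by blast
  have zero: "fa_act sc act Q1 w = 0" "fa_act sc act Q2 w = 0"
    using max_sub_relations(1)[OF M V hw Q] by blast+
  show ?thesis
  proof
    assume *: "simple_rep UNIV ts T ta"
    show "\<forall>n\<in>M. (rhoQ a b F n Q1, rhoQ a b F n Q2) \<noteq> (0, 0)"
    proof (intro ballI notI)
      fix n assume n: "n \<in> M" "(rhoQ a b F n Q1, rhoQ a b F n Q2) = (0, 0)"
      have \<rho>: "rhoQ a b F n Q1 = 0" "rhoQ a b F n Q2 = 0" using n(2) by simp_all
      have "\<not> simple_rep UNIV ts T ta"
      proof (rule not_simple_T[OF w(1) C n(1)])
        fix m P assume "\<forall>(c, u)\<in>set P. neg_word UNIV u" "fa_act sc act P w = 0"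
        then show "(\<Sum>(c, u)\<leftarrow>P. c * theta a b F n m u) = 0"
          by (rule max_sub_relations(2)[OF M V hw Q \<rho>])
      qed
      with * show False by blast
    qed
  next
    assume *: "\<forall>n\<in>M. (rhoQ a b F n Q1, rhoQ a b F n Q2) \<noteq> (0, 0)"
    show "simple_rep UNIV ts T ta"
    proof (rule simple_T_if_descent[OF V w(2,3)])
      fix S n assume S: "submodule UNIV ts T ta S" and n: "\<And>m. m > n \<Longrightarrow> ten w m \<in> S" "n \<in> M"
      show "ten w n \<in> S"
      proof (cases "rhoQ a b F n Q1 = 0")
        case False
        then show ?thesis using descent_by_relation[OF S w(2) n(1) Q(1)] zero by blast
      next
        case True
        then have "rhoQ a b F n Q2 \<noteq> 0" using * n(2) by auto
        then show ?thesis using descent_by_relation[OF S w(2) n(1) Q(2)] zero by blast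
      qed
    qed
  qed
qed

end

section \<open>The case where I_0, z_2, z_3 act by zero on the highest weight vector\<close>

lemma simple_tensor_J_nonzero:
  assumes "F \<noteq> 0" and V: "is_V_L sc C act 0 d0 z1 0 0"
  shows "simple_rep UNIV (tsc sc) (tens_carrier C UNIV) (tens_act sc act a b F UNIV)"
proof -
  interpret tensor_rep sc C act a b F UNIV
    using V \<open>F \<noteq> 0\<close> by unfold_locales (simp_all add: is_V_L_def)
  obtain w where w: "w \<in> C" "w \<noteq> 0" using V by (auto simp: is_V_L_def is_hw_L_def)
  show ?thesis
  proof (rule simple_T_if_descent[OF V w])
    fix S n assume S: "submodule UNIV ts T ta S" and n: "\<And>m. m > n \<Longrightarrow> ten w m \<in> S"
    have "ta (J (- 1)) (ten w (n + 1)) \<in> S" using S n by (simp add: submodule_def)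
    then have "ts F (ten w n) \<in> S"
      unfolding ta_ten using J_act_zero(1)[OF V w(1)] by (simp add: ten_zero)
    then show "ten w n \<in> S"
      using T.subspace_scale_cancel \<open>F \<noteq> 0\<close> S by (auto simp: submodule_def)
  qed
qed

lemma simple_rep_UNIV_iff_Vir:
  assumes "\<And>g x. g \<notin> Vir_gens \<Longrightarrow> x \<in> C \<Longrightarrow> act g x = 0" "vector_space sc"
  shows "simple_rep UNIV sc C act \<longleftrightarrow> simple_rep Vir_gens sc C act"
proof -
  have "submodule UNIV sc C act S \<longleftrightarrow> submodule Vir_gens sc C act S" for S
  proof
    interpret vector_space sc by (rule assms)
    assume S: "submodule Vir_gens sc C act S"
    then have "act g x \<in> S" if "x \<in> S" for g x
      using that assms(1)[of g x] subspace_0[of S]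
      by (cases "g \<in> Vir_gens") (auto simp: submodule_def)
    then show "submodule UNIV sc C act S" using S by (simp add: submodule_def)
  qed (auto simp: submodule_def)
  then show ?thesis by (simp add: simple_rep_def)
qed

text \<open>Submodules are pulled back along f \<mapsto> \<phi> o f. Only one implication is stated;
  the other comes from an isomorphism in the opposite direction.\<close>

lemma simple_tensor_transfer:
  assumes A: "is_rep G sc C act" and \<phi>: "rep_hom G sc C act sc' C' act' \<phi>" "bij_betw \<phi> C C'"
    and B: "is_rep G sc' C' act'"
    and simple: "simple_rep G (tsc sc) (tens_carrier C M) (tens_act sc act a b F M)"
  shows "simple_rep G (tsc sc') (tens_carrier C' M) (tens_act sc' act' a b F M)"
proof -
  interpret A: rep_space G sc C act using A by unfold_locales
  interpret B: rep_space G sc' C' act' using B by unfold_locales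
  let ?T = "tens_carrier C M" and ?T' = "tens_carrier C' M"
  let ?t = "tens_act sc act a b F M" and ?t' = "tens_act sc' act' a b F M"
  have hom: "x \<in> C \<Longrightarrow> \<phi> x \<in> C'" "x \<in> C \<Longrightarrow> y \<in> C \<Longrightarrow> \<phi> (x + y) = \<phi> x + \<phi> y"
    "x \<in> C \<Longrightarrow> \<phi> (sc c x) = sc' c (\<phi> x)" "g \<in> G \<Longrightarrow> x \<in> C \<Longrightarrow> \<phi> (act g x) = act' g (\<phi> x)" for x y c g
    using \<phi>(1) by (simp_all add: rep_hom_def)
  have \<phi>0: "\<phi> 0 = 0" using hom(3)[OF A.zero_in, of 0] by simp
  have \<phi>0_iff: "\<phi> x = 0 \<longleftrightarrow> x = 0" if "x \<in> C" for x
    using \<phi>(2) \<phi>0 A.zero_in that unfolding bij_betw_def inj_on_def by metis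
  have in_T': "\<phi> \<circ> f \<in> ?T'" if "f \<in> ?T" for f
    using that hom(1) by (auto simp: tens_carrier_def \<phi>0 \<phi>0_iff)
  have lift: "\<exists>f\<in>?T. h = \<phi> \<circ> f" if h: "h \<in> ?T'" for h
  proof
    let ?f = "\<lambda>m. inv_into C \<phi> (h m)"
    have h': "h m \<in> \<phi> ` C" for m using h \<phi>(2) by (auto simp: tens_carrier_def bij_betw_def)
    show eq: "h = \<phi> \<circ> ?f" using f_inv_into_f[OF h'] by auto
    have fC: "?f m \<in> C" for m by (rule inv_into_into[OF h'])
    have z: "h m = 0 \<longleftrightarrow> ?f m = 0" for m using \<phi>0_iff[OF fC] f_inv_into_f[OF h'] by metis
    show "?f \<in> ?T" using h fC z by (auto simp: tens_carrier_def)
  qed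
  have act: "\<phi> \<circ> ?t g f = ?t' g (\<phi> \<circ> f)" if "g \<in> G" "f \<in> ?T" for g f
    using that by (auto simp: fun_eq_iff tens_act_def hom A.act_in A.scale_in A.zero_in \<phi>0
        tens_carrier_def split: gen.split)
  have sca: "\<phi> \<circ> tsc sc c f = tsc sc' c (\<phi> \<circ> f)" if "f \<in> ?T" for c f
    using that by (auto simp: fun_eq_iff tsc_def hom tens_carrier_def)
  have add: "\<phi> \<circ> (f + h) = (\<phi> \<circ> f) + (\<phi> \<circ> h)" if "f \<in> ?T" "h \<in> ?T" for f h
    using that by (auto simp: fun_eq_iff hom tens_carrier_def)
  have zero: "\<phi> \<circ> f = 0 \<longleftrightarrow> f = 0" if "f \<in> ?T" for f
    using that by (auto simp: fun_eq_iff \<phi>0_iff tens_carrier_def)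
  interpret TA: vector_space "tsc sc"
    by unfold_locales (auto simp: tsc_def fun_eq_iff A.scale_right_distrib A.scale_left_distrib)
  interpret TB: vector_space "tsc sc'"
    by unfold_locales (auto simp: tsc_def fun_eq_iff B.scale_right_distrib B.scale_left_distrib)
  have T0: "0 \<in> ?T" by (simp add: tens_carrier_def A.zero_in)
  show ?thesis
    unfolding simple_rep_def
  proof (intro conjI allI impI)
    obtain f where "f \<in> ?T" "f \<noteq> 0" using simple T0 unfolding simple_rep_def by auto
    then show "?T' \<noteq> {0}" using in_T' zero by force
    fix S' assume S': "submodule G (tsc sc') ?T' ?t' S'"
    let ?S = "{f\<in>?T. \<phi> \<circ> f \<in> S'}"
    have "submodule G (tsc sc) ?T ?t ?S"
      unfolding submodule_def TA.subspace_def
    proof (intro conjI ballI allI)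
      have S's: "TB.subspace S'" using S' by (simp add: submodule_def)
      show "0 \<in> ?S" using T0 zero[OF T0] TB.subspace_0[OF S's] by simp
      have closed: "f + h \<in> ?T" "tsc sc c f \<in> ?T" if "f \<in> ?T" "h \<in> ?T" for c f h
      proof -
        have fin: "finite ({m. f m \<noteq> 0} \<union> {m. h m \<noteq> 0})"
          using that by (simp add: tens_carrier_def)
        have "finite {m. (f + h) m \<noteq> 0}" by (rule finite_subset[OF _ fin]) auto
        moreover have "finite {m. tsc sc c f m \<noteq> 0}"
          by (rule finite_subset[OF _ fin]) (auto simp: tsc_def)
        ultimately show "f + h \<in> ?T" "tsc sc c f \<in> ?T"
          using that by (simp_all add: tens_carrier_def tsc_def A.add_in A.scale_in)
      qed
      show "f + h \<in> ?S" if "f \<in> ?S" "h \<in> ?S" for f h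
        using that closed add TB.subspace_add[OF S's] by auto
      show "tsc sc c f \<in> ?S" if "f \<in> ?S" for c f
        using that closed sca TB.subspace_scale[OF S's] by auto
      show "?t g f \<in> ?S" if g: "g \<in> G" and f: "f \<in> ?S" for g f
      proof -
        have "?t' g (\<phi> \<circ> f) \<in> S'" using S' g f by (simp add: submodule_def)
        then have 1: "\<phi> \<circ> ?t g f \<in> S'" using act g f by simp
        \<comment> \<open>Finite support of \<open>?t g f\<close> is read off from its image in
          \<open>S'\<close>, since \<phi> vanishes only at 0.\<close>
        then have "\<phi> \<circ> ?t g f \<in> ?T'" using S' by (auto simp: submodule_def)
        moreover have "?t g f m \<in> C" for m
          using f g by (auto simp: tens_act_def tens_carrier_def A.act_in A.scale_in A.add_in A.zero_in
              split: gen.split)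
        ultimately have "?t g f \<in> ?T"
          by (auto simp: tens_carrier_def \<phi>0_iff)
        with 1 show ?thesis by simp
      qed
    qed auto
    then consider "?S = {0}" | "?S = ?T" using simple unfolding simple_rep_def by blast
    then show "S' = {0} \<or> S' = ?T'"
    proof cases
      case 1
      have "h = 0" if "h \<in> S'" for h
      proof -
        have "h \<in> ?T'" using S' that by (auto simp: submodule_def)
        then obtain f where f: "f \<in> ?T" "h = \<phi> \<circ> f" using lift by blast
        then have "f \<in> ?S" using that by simp
        then have "f = 0" using 1 by blast
        then show ?thesis using zero[OF f(1)] f(2) by simp
      qed
      moreover have "0 \<in> S'" using S' TB.subspace_0 by (auto simp: submodule_def)
      ultimately show ?thesis by blast
    next
      case 2
      have "h \<in> S'" if "h \<in> ?T'" for h using lift[OF that] 2 by blast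
      then show ?thesis using S' by (auto simp: submodule_def)
    qed
  qed
qed

text \<open>The surjection between highest weight modules has a kernel that misses the highest
  weight vector, hence is zero by simplicity of the source.\<close>

lemma simple_hw_iso:
  assumes A: "lie_rep G sc C act" "hwv G sc C act \<chi> w" "simple_rep G sc C act"
    and B: "lie_rep G sc' C' act'" "hwv G sc' C' act' \<chi> w'" "simple_rep G sc' C' act'"
  shows "\<exists>\<phi>. rep_hom G sc C act sc' C' act' \<phi> \<and> bij_betw \<phi> C C'"
proof -
  interpret A: lie_rep G sc C act by (rule A)
  interpret B: lie_rep G sc' C' act' by (rule B)
  obtain \<phi> where \<phi>: "rep_hom G sc C act sc' C' act' \<phi>" "\<phi> w = w'" "\<phi> ` C = C'"
    using hw_quotient_map[OF A(1,2) A.simple_eq_neg_span[OF A(3,2)] B] by blast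
  have hom: "x \<in> C \<Longrightarrow> y \<in> C \<Longrightarrow> \<phi> (x + y) = \<phi> x + \<phi> y"
    "x \<in> C \<Longrightarrow> \<phi> (sc c x) = sc' c (\<phi> x)" "g \<in> G \<Longrightarrow> x \<in> C \<Longrightarrow> \<phi> (act g x) = act' g (\<phi> x)" for x y c g
    using \<phi>(1) by (simp_all add: rep_hom_def)
  have \<phi>0: "\<phi> 0 = 0" using hom(2)[OF A.zero_in, of 0] by simp
  have "submodule G sc C act {x\<in>C. \<phi> x = 0}"
    by (rule A.submoduleI)
      (auto simp: A.zero_in A.add_in A.scale_in A.act_in hom \<phi>0 B.act_zero)
  moreover have "w \<in> C" "\<phi> w \<noteq> 0" using A(2) B(2) \<phi>(2) by (auto simp: hwv_def)
  ultimately have ker: "{x\<in>C. \<phi> x = 0} = {0}" using A(3) unfolding simple_rep_def by blast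
  have "inj_on \<phi> C"
  proof (rule inj_onI)
    fix x y assume xy: "x \<in> C" "y \<in> C" "\<phi> x = \<phi> y"
    have "\<phi> (x + sc (- 1) y) = \<phi> x + sc' (- 1) (\<phi> y)"
      using xy hom(1)[OF xy(1) A.scale_in[OF xy(2)], of "- 1"] hom(2)[OF xy(2), of "- 1"] by simp
    then have "x - y \<in> {x\<in>C. \<phi> x = 0}"
      using xy A.subspace_diff[OF A.subspace_C] by simp
    then show "x = y" using ker by simp
  qed
  then show ?thesis using \<phi> by (auto simp: bij_betw_def)
qed

text \<open>All I_n, z_2, z_3 act by zero on V and, as F = 0, on the tensor product. So V restricted
  to Vir is still simple, hence isomorphic to the given Vir-module, and submodules over L and over
  Vir coincide.\<close>

lemma simple_tensor_iff_Vir: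
  assumes V: "is_V_L sc C act 0 d0 z1 0 0" and W: "is_V_Vir sc' C' act' d0 z1"
  shows "simple_rep UNIV (tsc sc) (tens_carrier C M) (tens_act sc act a b 0 M)
    \<longleftrightarrow> simple_rep Vir_gens (tsc sc') (tens_carrier C' M) (tens_act sc' act' a b 0 M)"
proof -
  interpret L: lie_rep UNIV sc C act using V by unfold_locales (simp_all add: is_V_L_def)
  interpret W: lie_rep Vir_gens sc' C' act' using W by unfold_locales (simp_all add: is_V_Vir_def)
  interpret R: lie_rep Vir_gens sc C act
    using L.rep L.br_in by unfold_locales (auto simp: is_rep_def)
  have zero: "act g x = 0" if "g \<notin> Vir_gens" "x \<in> C" for g x
    using that J_act_zero[OF V] by (cases g) (auto simp: Vir_gens_def)
  obtain w where hw: "is_hw_L sc C act 0 d0 z1 0 0 w" using V by (auto simp: is_V_L_def)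
  obtain w' where hw': "is_hw_Vir sc' C' act' d0 z1 w'" using W by (auto simp: is_V_Vir_def)
  have w: "hwv Vir_gens sc C act (hw_fun 0 d0 z1 0 0) w"
    using is_hw_L_hwv[OF L.vector_space_axioms hw] by (simp add: hwv_def)
  have w': "hwv Vir_gens sc' C' act' (hw_fun 0 d0 z1 0 0) w'"
    by (rule is_hw_Vir_hwv[OF W.vector_space_axioms hw'])
  have sV: "simple_rep Vir_gens sc C act"
    using V simple_rep_UNIV_iff_Vir[OF zero L.vector_space_axioms] by (simp add: is_V_L_def)
  have sW: "simple_rep Vir_gens sc' C' act'" using W by (simp add: is_V_Vir_def)
  obtain \<phi> where \<phi>: "rep_hom Vir_gens sc C act sc' C' act' \<phi>" "bij_betw \<phi> C C'"
    using simple_hw_iso[OF R.lie_rep_axioms w sV W.lie_rep_axioms w' sW] by blast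
  obtain \<phi>' where \<phi>': "rep_hom Vir_gens sc' C' act' sc C act \<phi>'" "bij_betw \<phi>' C' C"
    using simple_hw_iso[OF W.lie_rep_axioms w' sW R.lie_rep_axioms w sV] by blast
  have "tens_act sc act a b 0 M g f = 0" if "g \<notin> Vir_gens" "f \<in> tens_carrier C M" for g f
    using that by (cases g)
      (auto simp: fun_eq_iff tens_act_def zero tens_carrier_def Vir_gens_def)
  moreover have "vector_space (tsc sc)"
    by unfold_locales (auto simp: tsc_def fun_eq_iff L.scale_right_distrib L.scale_left_distrib)
  ultimately have "simple_rep UNIV (tsc sc) (tens_carrier C M) (tens_act sc act a b 0 M)
    \<longleftrightarrow> simple_rep Vir_gens (tsc sc) (tens_carrier C M) (tens_act sc act a b 0 M)"
    by (intro simple_rep_UNIV_iff_Vir)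
  then show ?thesis
    using simple_tensor_transfer[OF R.rep \<phi> W.rep] simple_tensor_transfer[OF W.rep \<phi>' R.rep] by blast
qed

text \<open>In the excluded case x^m spans a one-dimensional submodule; x^(m+1) lies outside it.
  This supplies the locale condition with \<open>M = UNIV\<close>.\<close>

lemma A_simple_nondegenerate:
  assumes simple: "simple_rep UNIV (tsc (*)) A_carrier (A_act a b F)"
  shows "\<not> (a + of_int m = 0 \<and> b = 0 \<and> F = 0)"
proof
  assume *: "a + of_int m = 0 \<and> b = 0 \<and> F = 0"
  interpret vector_space "tsc (*) :: complex \<Rightarrow> (int \<Rightarrow> complex) \<Rightarrow> int \<Rightarrow> complex"
    by unfold_locales (auto simp: tsc_def fun_eq_iff algebra_simps)
  let ?S = "{f. \<forall>i. i \<noteq> m \<longrightarrow> f i = (0 :: complex)}"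
  have "f \<in> A_carrier" if "f \<in> ?S" for f
    using that by (auto simp: A_carrier_def intro!: finite_subset[of _ "{m}"])
  moreover have "A_act a b F g f \<in> ?S" if "f \<in> ?S" for g f
  proof -
    have "(a + of_int k) * f k = 0" for k using that * by (cases "k = m") auto
    then show ?thesis using * by (cases g) (auto simp: A_act_def simp del: of_int_diff mult_eq_0_iff)
  qed
  ultimately have "submodule UNIV (tsc (*)) A_carrier (A_act a b F) ?S"
    unfolding submodule_def subspace_def by (auto simp: tsc_def)
  then have cases: "?S = {0} \<or> ?S = A_carrier" using simple unfolding simple_rep_def by blast
  define e where "e k = (\<lambda>i. if i = k then 1 else 0 :: complex)" for k :: int
  have "e m \<in> ?S" "e m m \<noteq> 0" by (auto simp: e_def)
  then have "?S \<noteq> {0}" by (metis singletonD zero_fun_apply)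
  moreover have "e (m + 1) \<in> A_carrier" "e (m + 1) \<notin> ?S" by (auto simp: A_carrier_def e_def)
  ultimately show False using cases by metis
qed

theorem theorem26:
  fixes a b F I0 d0 z1 z2 z3 :: complex
  shows
  "(F \<noteq> 0 \<longrightarrow>
     (\<forall>(sc :: complex \<Rightarrow> 'v::ab_group_add \<Rightarrow> 'v) C act.
        is_V_L sc C act 0 d0 z1 0 0 \<longrightarrow>
        simple_rep UNIV (tsc sc) (tens_carrier C (Aprime_set a b F))
          (tens_act sc act a b F (Aprime_set a b F))))
 \<and> (\<forall>(sc :: complex \<Rightarrow> 'v \<Rightarrow> 'v) C act (scw :: complex \<Rightarrow> 'w::ab_group_add \<Rightarrow> 'w) Cw actw.
        is_V_L sc C act 0 d0 z1 0 0 \<longrightarrow> is_V_Vir scw Cw actw d0 z1 \<longrightarrow>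
        (simple_rep UNIV (tsc sc) (tens_carrier C (Aprime_set a b 0))
            (tens_act sc act a b 0 (Aprime_set a b 0))
         \<longleftrightarrow> simple_rep Vir_gens (tsc scw) (tens_carrier Cw (Aprime_set a b 0))
            (tens_act scw actw a b 0 (Aprime_set a b 0))))
 \<and> ((I0, z2, z3) \<noteq> (0, 0, 0) \<longrightarrow> simple_rep UNIV (tsc (*)) A_carrier (A_act a b F) \<longrightarrow>
     (\<forall>(scm :: complex \<Rightarrow> 'm::ab_group_add \<Rightarrow> 'm) Cm actm w Q1 Q2 (sc :: complex \<Rightarrow> 'v \<Rightarrow> 'v) C act.
        is_Verma scm Cm actm I0 d0 z1 z2 z3 w \<longrightarrow> homog Q1 \<longrightarrow> homog Q2 \<longrightarrow>
        max_sub_gen scm Cm actm w Q1 Q2 \<longrightarrow> is_V_L sc C act I0 d0 z1 z2 z3 \<longrightarrow>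
        (simple_rep UNIV (tsc sc) (tens_carrier C UNIV) (tens_act sc act a b F UNIV)
         \<longleftrightarrow> (\<forall>n::int. (rhoQ a b F n Q1, rhoQ a b F n Q2) \<noteq> (0, 0)))))
 \<and> ((I0, z2, z3) \<noteq> (0, 0, 0) \<longrightarrow>
     (\<forall>(scm :: complex \<Rightarrow> 'm \<Rightarrow> 'm) Cm actm w Q1 Q2 (sc :: complex \<Rightarrow> 'v \<Rightarrow> 'v) C act.
        is_Verma scm Cm actm I0 d0 z1 z2 z3 w \<longrightarrow> homog Q1 \<longrightarrow> homog Q2 \<longrightarrow>
        max_sub_gen scm Cm actm w Q1 Q2 \<longrightarrow> is_V_L sc C act I0 d0 z1 z2 z3 \<longrightarrow>
        (simple_rep UNIV (tsc sc) (tens_carrier C (Aprime_set 0 0 0)) (tens_act sc act 0 0 0 (Aprime_set 0 0 0))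
         \<longleftrightarrow> (\<forall>n::int. n \<noteq> 0 \<longrightarrow> (rhoQ 0 0 0 n Q1, rhoQ 0 0 0 n Q2) \<noteq> (0, 0)))))"
proof (intro conjI impI allI)
  fix sc :: "complex \<Rightarrow> 'v \<Rightarrow> 'v" and C act
  assume "F \<noteq> 0" "is_V_L sc C act 0 d0 z1 0 0"
  then show "simple_rep UNIV (tsc sc) (tens_carrier C (Aprime_set a b F))
      (tens_act sc act a b F (Aprime_set a b F))"
    using simple_tensor_J_nonzero by (simp add: Aprime_set_def)
next
  fix sc :: "complex \<Rightarrow> 'v \<Rightarrow> 'v" and C act and scw :: "complex \<Rightarrow> 'w \<Rightarrow> 'w" and Cw actw
  assume "is_V_L sc C act 0 d0 z1 0 0" "is_V_Vir scw Cw actw d0 z1"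
  then show "simple_rep UNIV (tsc sc) (tens_carrier C (Aprime_set a b 0))
      (tens_act sc act a b 0 (Aprime_set a b 0))
    \<longleftrightarrow> simple_rep Vir_gens (tsc scw) (tens_carrier Cw (Aprime_set a b 0))
      (tens_act scw actw a b 0 (Aprime_set a b 0))"
    by (rule simple_tensor_iff_Vir)
next
  fix scm :: "complex \<Rightarrow> 'm \<Rightarrow> 'm" and Cm actm w Q1 Q2
    and sc :: "complex \<Rightarrow> 'v \<Rightarrow> 'v" and C act
  assume simple: "simple_rep UNIV (tsc (*)) A_carrier (A_act a b F)"
    and M: "is_Verma scm Cm actm I0 d0 z1 z2 z3 w"
    and Q: "homog Q1" "homog Q2" and max: "max_sub_gen scm Cm actm w Q1 Q2"
    and V: "is_V_L sc C act I0 d0 z1 z2 z3"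
  interpret tensor_rep sc C act a b F UNIV
    using V A_simple_nondegenerate[OF simple] by unfold_locales (simp_all add: is_V_L_def)
  show "simple_rep UNIV (tsc sc) (tens_carrier C UNIV) (tens_act sc act a b F UNIV)
    \<longleftrightarrow> (\<forall>n::int. (rhoQ a b F n Q1, rhoQ a b F n Q2) \<noteq> (0, 0))"
    using simple_T_iff[OF M max Q V] by simp
next
  fix scm :: "complex \<Rightarrow> 'm \<Rightarrow> 'm" and Cm actm w Q1 Q2
    and sc :: "complex \<Rightarrow> 'v \<Rightarrow> 'v" and C act
  assume M: "is_Verma scm Cm actm I0 d0 z1 z2 z3 w"
    and Q: "homog Q1" "homog Q2" and max: "max_sub_gen scm Cm actm w Q1 Q2"
    and V: "is_V_L sc C act I0 d0 z1 z2 z3"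
  \<comment> \<open>For (a,b,F) = (0,0,0) the single missing index is 0, which accounts for the
    exception n = 0.\<close>
  interpret tensor_rep sc C act 0 0 0 "Aprime_set 0 0 0"
    using V by unfold_locales (simp_all add: is_V_L_def Aprime_set_def)
  show "simple_rep UNIV (tsc sc) (tens_carrier C (Aprime_set 0 0 0))
      (tens_act sc act 0 0 0 (Aprime_set 0 0 0))
    \<longleftrightarrow> (\<forall>n::int. n \<noteq> 0 \<longrightarrow> (rhoQ 0 0 0 n Q1, rhoQ 0 0 0 n Q2) \<noteq> (0, 0))"
    using simple_T_iff[OF M max Q V] by (simp add: Aprime_set_def)
qed

end
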